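(* The dependence of the characteristic functions $U=\breve U(x,\theta)$ and $f=\breve f(x,\theta)$ of the ${\cal UZ}$-Finsleroid space on the argument $\theta$ can be found explicitly upon integrating the ${\cal UZ}$-Finsleroid characteristic equations $$\Big(\frac{\partial\breve\theta}{\partial f}\Big)^2=H^2\,\frac1U\,\frac{\partial^2\hat U}{\partial f^2},\qquad \frac1U\,\frac{\partial\hat U}{\partial f}\,f=T\sin^2\theta,\qquad T=\frac{C}{H^2},$$ where $T=T(x)$, $C=C(x)$, $H=H(x)$. Namely, the respective representations are $$\breve U=C_{22}\,\frac{1}{R_{17}}\,I,\quad C_{22}=C_{22}(x),\qquad\text{and}\qquad \breve f=C_{33}\,\frac{\sin\theta}{R_{17}}\,Y_1,\quad C_{33}=C_{33}(x).$$ Here $$R_{17}=\cos\theta+\sqrt{L_{17}},\qquad L_{17}=\Big(\frac1{H^2}-\frac1C\Big)\sin^2\theta+\Big(1-\frac1C\Big)\cos^2\theta,$$ $$P_1=1-\frac1C,\qquad H_1=\frac1{H^2}-1,\qquad H_2=\frac1{H^2}-\frac1C,$$ $$I=\exp\Big(-\sqrt{H_1}\,\arcsin\Big(\sqrt{\tfrac{H_1}{H_2}}\,\cos\theta\Big)\Big),$$ $$Y=\Big(\frac{1}{\sqrt{H_2}\,\sin\theta}\big(\sqrt{L_{17}}+\sqrt{P_1}\cos\theta\big)\Big)^2,\qquad Y_1=Y^{\frac12\sqrt{P_1}}.$$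
   Context: Let $M$ be a three-dimensional differentiable manifold carrying three one-forms $i=i_iy^i$, $j=j_iy^i$, $i_{\{3\}}=i_{\{3\}i}y^i$ (basis vector fields), linearly independent at each point $x$, with the background Riemannian metric $a_{ij}=i_ii_j+j_ij_j+i_{\{3\}i}i_{\{3\}j}$. For a tangent vector $y$ at $x$ put $y^1=i$, $y^2=j$, $y^3=i_{\{3\}}$, $z=y^3$, $c^1=y^1/z$, $c^2=y^2/z$, $t=y^1/y^2$, assuming $z>0$, $j>0$, $c^2>0$. Finsler metric functions $F(x,y)$ are sufficiently smooth, positively homogeneous of degree one in $y$, with positive-definite metric tensor $g_{ij}=\frac12\partial^2F^2/\partial y^i\partial y^j$. A ${\cal UZ}$-Finsler space is one whose metric function has the form $F=z\,\hat U(x,f)$, $f=c^2\hat Z(x,t)$, where the characteristic functions $U,f,Z,t$ have separated dependence on two angles $\theta,\phi$ (scalars homogeneous of degree zero in $y$): $U=\breve U(x,\theta)$, $f=\breve f(x,\theta)$, $Z=\breve Z(x,\phi)$, $t=\breve t(x,\phi)$; thus $\breve U(x,\theta)=\hat U(x,\breve f(x,\theta))$, $\breve Z(x,\phi)=\hat Z(x,\breve t(x,\phi))$, $\theta=\breve\theta(x,f)$ and $\phi=\breve\phi(x,t)$. The ${\cal UZ}$-Finsler space is a ${\cal UZ}$-Finsleroid space if it is a Finsleroid space, i.e. its indicatrix $\{y:F(x,y)=1\}$ in each tangent space has constant positive curvature $H^2=H(x)^2$, with $0<H\le1$, the metric tensor having the angle representation $g_{ij}=l_il_j+\frac1{H^2}(\theta_i\theta_j+\sin^2\theta\,\phi_i\phi_j)F^2$,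 where $l_i,\theta_i,\phi_i$ are the derivatives of $F,\theta,\phi$ with respect to $y^i$. The function $C=C(x)$ is the factor which appears in the associated equation for the angle $\phi=\breve\phi(x,t)$, namely $(\partial\breve\phi/\partial t)^2=C\,\frac1Z\,\partial^2\hat Z/\partial t^2$.
   Formalization: The angle θ is assumed oriented so that (f/sin θ) ∂θ/∂f ≥ C cos θ; the defining conditions are unchanged under θ → π−θ, and for H<1 the stated formulas fail for the opposite labelling. *)

theory Defs
  imports "HOL-Analysis.Analysis"
begin

section \<open>Differentiability classes and partial derivatives\<close>

primrec Ck_on ::
  "nat \<Rightarrow> ('a::euclidean_space \<Rightarrow> 'b::real_normed_vector) \<Rightarrow> 'a set \<Rightarrow> bool" where
  "Ck_on 0 f S \<longleftrightarrow> continuous_on S f"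
| "Ck_on (Suc k) f S \<longleftrightarrow>
     (\<exists>f'. (\<forall>x\<in>S. (f has_derivative f' x) (at x)) \<and> (\<forall>v. Ck_on k (\<lambda>x. f' x v) S))"

definition pd :: "'n::finite \<Rightarrow> (real ^ 'n \<Rightarrow> real) \<Rightarrow> real ^ 'n \<Rightarrow> real" where
  "pd i f u = deriv (\<lambda>s. f (u + s *\<^sub>R axis i 1)) 0"

section \<open>Curvature of a Riemannian metric given in coordinates\<close>

definition christoffel ::
  "(real ^ 'n \<Rightarrow> real ^ 'n ^ 'n) \<Rightarrow> 'n \<Rightarrow> 'n \<Rightarrow> 'n \<Rightarrow> real ^ 'n::finite \<Rightarrow> real" where
  "christoffel \<gamma> l i j u =
     (1/2) * (\<Sum>m\<in>UNIV. matrix_inv (\<gamma> u) $ l $ m *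
        (pd i (\<lambda>v. \<gamma> v $ j $ m) u + pd j (\<lambda>v. \<gamma> v $ i $ m) u - pd m (\<lambda>v. \<gamma> v $ i $ j) u))"

text \<open>The component along the \<open>l\<close>-th coordinate field of \<open>R(X\<^sub>i, X\<^sub>j) X\<^sub>k\<close>, with
  \<open>R(X, Y) = [\<nabla>\<^sub>X, \<nabla>\<^sub>Y] - \<nabla>\<^bsub>[X,Y]\<^esub>\<close>.\<close>

definition riemann ::
  "(real ^ 'n \<Rightarrow> real ^ 'n ^ 'n) \<Rightarrow> 'n \<Rightarrow> 'n \<Rightarrow> 'n \<Rightarrow> 'n \<Rightarrow> real ^ 'n::finite \<Rightarrow> real" where
  "riemann \<gamma> l k i j u =
     pd i (christoffel \<gamma> l j k) u - pd j (christoffel \<gamma> l i k) u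
     + (\<Sum>m\<in>UNIV. christoffel \<gamma> l i m u * christoffel \<gamma> m j k u
                 - christoffel \<gamma> l j m u * christoffel \<gamma> m i k u)"

definition has_constant_curvature ::
  "(real ^ 'n \<Rightarrow> real ^ 'n ^ 'n) \<Rightarrow> (real ^ 'n::finite) set \<Rightarrow> real \<Rightarrow> bool" where
  "has_constant_curvature \<gamma> V \<kappa> \<longleftrightarrow>
     (\<forall>u\<in>V. \<forall>l k i j. riemann \<gamma> l k i j u =
        \<kappa> * ((if l = i then \<gamma> u $ j $ k else 0) - (if l = j then \<gamma> u $ i $ k else 0)))"

section \<open>Three-dimensional manifolds with a coframe\<close>

text \<open>The manifold is the type \<open>'m\<close>. Each point \<open>x\<close> comes with a chart \<open>crd x\<close> on an open
  neighbourhood \<open>cdom x\<close>; these charts form the atlas. A tangent vector at \<open>x\<close> is represented by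
  its components \<open>y\<^sup>i\<close> in the natural frame of the chart \<open>crd x\<close>, and a covector likewise.
  Smooth dependence on the point is tested in each chart of the atlas, after passing to the
  components at \<open>p\<close> by \<open>tangent_change x0 p\<close>.\<close>

locale manifold3 =
  fixes cdom :: "'m::{t2_space,second_countable_topology} \<Rightarrow> 'm set"
    and crd :: "'m \<Rightarrow> 'm \<Rightarrow> real ^ 3"
  assumes in_chart: "x \<in> cdom x"
    and open_chart: "open (cdom x)" "open (crd x ` cdom x)"
    and chart_homeo: "homeomorphism (cdom x) (crd x ` cdom x) (crd x) (inv_into (cdom x) (crd x))"
    and transition_smooth:
      "Ck_on n (crd x' \<circ> inv_into (cdom x) (crd x)) (crd x ` (cdom x \<inter> cdom x'))"
begin

definition pt :: "'m \<Rightarrow> real ^ 3 \<Rightarrow> 'm" where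
  "pt x0 = inv_into (cdom x0) (crd x0)"

definition tangent_change :: "'m \<Rightarrow> 'm \<Rightarrow> real ^ 3 \<Rightarrow> real ^ 3" where
  "tangent_change x0 p = frechet_derivative (crd p \<circ> pt x0) (at (crd x0 p))"

definition smooth_one_form :: "('m \<Rightarrow> real ^ 3) \<Rightarrow> bool" where
  "smooth_one_form \<omega> \<longleftrightarrow>
     (\<forall>x0 v n. Ck_on n (\<lambda>q. \<omega> (pt x0 q) \<bullet> tangent_change x0 (pt x0 q) v) (crd x0 ` cdom x0))"

end

text \<open>\<open>w1\<close>, \<open>w2\<close>, \<open>w3\<close> are the one-forms \<open>i\<close>, \<open>j\<close>, \<open>i\<^bsub>{3}\<^esub>\<close>, so that \<open>w1 x \<bullet> y\<close> is \<open>y\<^sup>1\<close>,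
  \<open>w2 x \<bullet> y\<close> is \<open>y\<^sup>2\<close> and \<open>w3 x \<bullet> y\<close> is \<open>z\<close>.\<close>

locale coframed_manifold3 = manifold3 cdom crd
  for cdom :: "'m::{t2_space,second_countable_topology} \<Rightarrow> 'm set"
    and crd :: "'m \<Rightarrow> 'm \<Rightarrow> real ^ 3" +
  fixes w1 w2 w3 :: "'m \<Rightarrow> real ^ 3"
  assumes forms_smooth: "smooth_one_form w1" "smooth_one_form w2" "smooth_one_form w3"
    and forms_independent: "distinct [w1 x, w2 x, w3 x]" "independent {w1 x, w2 x, w3 x}"
begin

definition cone :: "'m \<Rightarrow> (real ^ 3) set" where
  "cone x = {y. 0 < w2 x \<bullet> y \<and> 0 < w3 x \<bullet> y}"

definition c2 :: "'m \<Rightarrow> real ^ 3 \<Rightarrow> real" where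
  "c2 x y = (w2 x \<bullet> y) / (w3 x \<bullet> y)"

definition t_of :: "'m \<Rightarrow> real ^ 3 \<Rightarrow> real" where
  "t_of x y = (w1 x \<bullet> y) / (w2 x \<bullet> y)"

end

section \<open>Finsler metric functions\<close>

definition metric_tensor :: "(real ^ 3 \<Rightarrow> real) \<Rightarrow> real ^ 3 \<Rightarrow> real ^ 3 ^ 3" where
  "metric_tensor \<Phi> y = (\<chi> i j. (1/2) * pd i (pd j (\<lambda>u. (\<Phi> u)\<^sup>2)) y)"

text \<open>Class \<open>C\<^sup>4\<close> is what makes the curvature of the indicatrix a continuous function.\<close>

locale finsler_space = coframed_manifold3 cdom crd w1 w2 w3
  for cdom :: "'m::{t2_space,second_countable_topology} \<Rightarrow> 'm set"
    and crd :: "'m \<Rightarrow> 'm \<Rightarrow> real ^ 3"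
    and w1 w2 w3 :: "'m \<Rightarrow> real ^ 3" +
  fixes F :: "'m \<Rightarrow> real ^ 3 \<Rightarrow> real"
  assumes F_smooth:
      "Ck_on 4 (\<lambda>(q, v). F (pt x0 q) (tangent_change x0 (pt x0 q) v))
         {(q, v). q \<in> crd x0 ` cdom x0 \<and> tangent_change x0 (pt x0 q) v \<in> cone (pt x0 q)}"
    and F_pos: "y \<in> cone x \<Longrightarrow> 0 < F x y"
    and F_homogeneous: "\<lbrakk>y \<in> cone x; 0 < (s::real)\<rbrakk> \<Longrightarrow> F x (s *\<^sub>R y) = s * F x y"
    and metric_pos_def:
      "\<lbrakk>y \<in> cone x; v \<noteq> 0\<rbrakk> \<Longrightarrow> 0 < v \<bullet> (metric_tensor (F x) y *v v)"
begin

text \<open>The indicatrix carries the Riemannian metric induced by the metric tensor; the condition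
  refers to every local parametrization \<open>r\<close> of it.\<close>

definition indicatrix_curvature :: "'m \<Rightarrow> real \<Rightarrow> bool" where
  "indicatrix_curvature x \<kappa> \<longleftrightarrow>
     (\<forall>(V :: (real ^ 2) set) r. open V \<and> Ck_on 3 r V \<and>
        (\<forall>u\<in>V. r u \<in> cone x \<and> F x (r u) = 1 \<and> inj (frechet_derivative r (at u))) \<longrightarrow>
        has_constant_curvature
          (\<lambda>u. \<chi> a b. frechet_derivative r (at u) (axis a 1) \<bullet>
             (metric_tensor (F x) (r u) *v frechet_derivative r (at u) (axis b 1))) V \<kappa>)"

end

section \<open>UZ-Finsler and UZ-Finsleroid spaces\<close>

text \<open>The values taken by \<open>f = c\<^sup>2 Z(x,t)\<close> on the cone; there \<open>c\<^sup>2\<close> ranges over all positive reals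
  and \<open>t\<close> over all reals, independently.\<close>

definition f_range :: "('m \<Rightarrow> real \<Rightarrow> real) \<Rightarrow> 'm \<Rightarrow> real set" where
  "f_range Zh x = {c * Zh x t | c t. 0 < c}"

text \<open>\<open>Uh\<close>, \<open>Zh\<close> are the hatted functions; \<open>Ub\<close>, \<open>fb\<close>, \<open>Zb\<close>, \<open>tb\<close>, \<open>\<theta>b\<close>, \<open>\<phi>b\<close> are the functions
  carrying a breve.\<close>

locale UZ_finsler_space = finsler_space cdom crd w1 w2 w3 F
  for cdom :: "'m::{t2_space,second_countable_topology} \<Rightarrow> 'm set"
    and crd :: "'m \<Rightarrow> 'm \<Rightarrow> real ^ 3"
    and w1 w2 w3 :: "'m \<Rightarrow> real ^ 3"
    and F :: "'m \<Rightarrow> real ^ 3 \<Rightarrow> real" +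
  fixes Uh Zh Ub fb Zb tb \<theta>b \<phi>b :: "'m \<Rightarrow> real \<Rightarrow> real"
  assumes F_form:
      "y \<in> cone x \<Longrightarrow> F x y = (w3 x \<bullet> y) * Uh x (c2 x y * Zh x (t_of x y))"
    and Uh_smooth: "Ck_on 2 (Uh x) (f_range Zh x)"
    and Zh_smooth: "Ck_on 2 (Zh x) UNIV"
    and \<theta>b_smooth: "Ck_on 1 (\<theta>b x) (f_range Zh x)"
    and \<phi>b_smooth: "Ck_on 1 (\<phi>b x) UNIV"
    and fb_\<theta>b: "f \<in> f_range Zh x \<Longrightarrow> fb x (\<theta>b x f) = f"
    and tb_\<phi>b: "tb x (\<phi>b x t) = t"
    and Ub_eq: "\<theta> \<in> \<theta>b x ` f_range Zh x \<Longrightarrow> Ub x \<theta> = Uh x (fb x \<theta>)"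
    and Zb_eq: "\<phi> \<in> range (\<phi>b x) \<Longrightarrow> Zb x \<phi> = Zh x (tb x \<phi>)"
begin

definition theta :: "'m \<Rightarrow> real ^ 3 \<Rightarrow> real" where
  "theta x y = \<theta>b x (c2 x y * Zh x (t_of x y))"

definition phi :: "'m \<Rightarrow> real ^ 3 \<Rightarrow> real" where
  "phi x y = \<phi>b x (t_of x y)"

end

locale UZ_finsleroid_space = UZ_finsler_space cdom crd w1 w2 w3 F Uh Zh Ub fb Zb tb \<theta>b \<phi>b
  for cdom :: "'m::{t2_space,second_countable_topology} \<Rightarrow> 'm set"
    and crd :: "'m \<Rightarrow> 'm \<Rightarrow> real ^ 3"
    and w1 w2 w3 :: "'m \<Rightarrow> real ^ 3"
    and F :: "'m \<Rightarrow> real ^ 3 \<Rightarrow> real"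
    and Uh Zh Ub fb Zb tb \<theta>b \<phi>b :: "'m \<Rightarrow> real \<Rightarrow> real" +
  fixes H :: "'m \<Rightarrow> real"
  assumes H_bounds: "0 < H x" "H x \<le> 1"
    and constant_curvature: "indicatrix_curvature x ((H x)\<^sup>2)"
    and angle_representation:
      "y \<in> cone x \<Longrightarrow>
       metric_tensor (F x) y $ i $ j =
         pd i (F x) y * pd j (F x) y
         + 1 / (H x)\<^sup>2 * (pd i (theta x) y * pd j (theta x) y
              + (sin (theta x y))\<^sup>2 * pd i (phi x) y * pd j (phi x) y) * (F x y)\<^sup>2"

section \<open>The explicit functions of \<open>\<theta>\<close>\<close>

definition P1 :: "real \<Rightarrow> real" where
  "P1 C = 1 - 1 / C"

definition H1 :: "real \<Rightarrow> real" where
  "H1 H = 1 / H\<^sup>2 - 1"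

definition H2 :: "real \<Rightarrow> real \<Rightarrow> real" where
  "H2 C H = 1 / H\<^sup>2 - 1 / C"

definition L17 :: "real \<Rightarrow> real \<Rightarrow> real \<Rightarrow> real" where
  "L17 C H \<theta> = (1 / H\<^sup>2 - 1 / C) * (sin \<theta>)\<^sup>2 + (1 - 1 / C) * (cos \<theta>)\<^sup>2"

definition R17 :: "real \<Rightarrow> real \<Rightarrow> real \<Rightarrow> real" where
  "R17 C H \<theta> = cos \<theta> + sqrt (L17 C H \<theta>)"

definition I_exp :: "real \<Rightarrow> real \<Rightarrow> real \<Rightarrow> real" where
  "I_exp C H \<theta> = exp (- sqrt (H1 H) * arcsin (sqrt (H1 H / H2 C H) * cos \<theta>))"

definition Y :: "real \<Rightarrow> real \<Rightarrow> real \<Rightarrow> real" where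
  "Y C H \<theta> = (1 / (sqrt (H2 C H) * sin \<theta>) * (sqrt (L17 C H \<theta>) + sqrt (P1 C) * cos \<theta>))\<^sup>2"

text \<open>A zero exponent gives \<open>1\<close>. This matters only for \<open>C = H = 1\<close>, where \<open>H\<^sub>2 = 0\<close>
  and \<open>Y\<close> is an expression \<open>0/0\<close>, whose value in HOL is \<open>0\<close>, while \<open>0 powr 0 = 0\<close>. In the same
  case \<open>I_exp\<close> equals \<open>1\<close> because of its factor \<open>sqrt (H1 H) = 0\<close>.\<close>

definition Y1 :: "real \<Rightarrow> real \<Rightarrow> real \<Rightarrow> real" where
  "Y1 C H \<theta> = (if P1 C = 0 then 1 else Y C H \<theta> powr (1/2 * sqrt (P1 C)))"

section \<open>Orientation of the angle \<open>\<theta>\<close>\<close>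

text \<open>The metric tensor in its angle representation does not change when \<open>\<theta>\<close> is replaced by
  \<open>\<pi> - \<theta>\<close>. The characteristic equations give
  \<open>(f / sin \<theta>) \<partial>\<theta>/\<partial>f = C (cos \<theta> \<plusminus> sqrt L\<^sub>1\<^sub>7)\<close>, and the replacement interchanges the two signs.
  The angle is measured from the end of the axis for which the radical enters with the sign
  it has in \<open>R\<^sub>1\<^sub>7\<close>.\<close>

definition theta_oriented ::
  "('m \<Rightarrow> real) \<Rightarrow> ('m \<Rightarrow> real \<Rightarrow> real) \<Rightarrow> ('m \<Rightarrow> real \<Rightarrow> real) \<Rightarrow> bool" where
  "theta_oriented C Zh \<theta>b \<longleftrightarrow>
     (\<forall>x. \<forall>f\<in>f_range Zh x. C x * cos (\<theta>b x f) \<le> f / sin (\<theta>b x f) * deriv (\<theta>b x) f)"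

end

theory Submission
  imports Defs
begin

text \<open>
  Fix a point \<open>x\<close> of the manifold. Everything happens in one tangent space, in the linear
  coordinates \<open>y\<^sup>1, y\<^sup>2, z\<close>, and the dependence on \<open>x\<close> enters only through the choice of the
  two integration constants.

  The characteristic equations are a comparison of coefficients. For \<open>F = z U(f)\<close> with
  \<open>f = (y\<^sup>2 / z) Z(t)\<close> and \<open>t = y\<^sup>1 / y\<^sup>2\<close>, homogeneity makes the mixed terms of the Hessian cancel:
  \<open>\<partial>\<^sub>i \<partial>\<^sub>j F = z U'' f\<^sub>i f\<^sub>j + U' y\<^sup>2 Z'' t\<^sub>i t\<^sub>j\<close>. So the metric tensor \<open>F\<^sub>i F\<^sub>j + F F\<^sub>i\<^sub>j\<close> has the same
  shape as its angle representation, and the covectors \<open>f\<^sub>i\<close>, \<open>t\<^sub>i\<close> are independent once \<open>Z\<close> has no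
  zero (\<open>metric_tensor_quadratic_form\<close>, \<open>angle_quadratic_form\<close>, \<open>characteristic_equations\<close>).
  Definiteness of the metric gives the nondegeneracy that the comparison needs: a zero of \<open>Z\<close>,
  of \<open>sin \<theta>\<close>, of \<open>\<partial>\<phi>/\<partial>t\<close> or of \<open>\<partial>\<theta>/\<partial>f\<close> would leave a null vector.

  Differentiating the second characteristic equation and eliminating \<open>U''\<close> with the first gives,
  for \<open>p = (f / sin \<theta>) \<partial>\<theta>/\<partial>f\<close>, the quadratic equation \<open>(p - C cos \<theta>)\<^sup>2 = C\<^sup>2 L\<^sub>1\<^sub>7\<close>
  (\<open>drift_quadratic\<close>). The orientation and \<open>C > 0\<close> select the root \<open>p = C R\<^sub>1\<^sub>7\<close>, which is a
  separable equation for \<open>\<theta>\<close> in the variable \<open>ln \<bar>f\<bar>\<close>. Along it the quotients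
  \<open>U R\<^sub>1\<^sub>7 / I\<close> and \<open>f R\<^sub>1\<^sub>7 / (sin \<theta> Y\<^sub>1)\<close> have zero derivative
  (\<open>integrated_characteristic_equations\<close>), and \<open>f\<close> ranges over an interval.

  The explicit formulas contain \<open>sqrt (1 - 1/C)\<close>, so they are meaningful only for \<open>C \<ge> 1\<close>. This
  is forced by the global domain, in two steps. If \<open>C < 0\<close>, then \<open>\<bar>Z\<bar>\<close> is positive and
  strictly concave on the whole line, which is impossible (\<open>C_pos\<close>). If \<open>0 < C < 1\<close>,
  then \<open>L\<^sub>1\<^sub>7 \<ge> 0\<close> keeps \<open>\<theta>\<close> away from the zeros of \<open>sin\<close>, and \<open>cos \<theta>\<close> changes at a rate
  bounded away from zero as \<open>ln \<bar>f\<bar>\<close> tends to \<open>-\<infinity>\<close>, so it cannot stay bounded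
  (\<open>full_angle_range_imp_C_ge_1\<close>).
\<close>

section \<open>Derivatives in coordinates\<close>
lemma Ck_on_1_real:
  fixes f :: "real \<Rightarrow> real"
  assumes "Ck_on 1 f S"
  shows "x \<in> S \<Longrightarrow> (f has_real_derivative deriv f x) (at x)"
    and "continuous_on S (deriv f)"
proof -
  obtain f' where f': "\<forall>x\<in>S. (f has_derivative f' x) (at x)" "\<forall>v. continuous_on S (\<lambda>x. f' x v)"
    using assms by auto
  have *: "(f has_real_derivative f' x 1) (at x)" if "x \<in> S" for x
    using f'(1) that
    by (metis has_derivative_imp_has_field_derivative linear_scale_real has_derivative_linear mult.commute mult.right_neutral)
  then have eq: "f' x 1 = deriv f x" if "x \<in> S" for x
    using DERIV_imp_deriv[OF *[OF that]] by simp
  show "(f has_real_derivative deriv f x) (at x)" if "x \<in> S"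
    using * eq that by metis
  have "continuous_on S (\<lambda>x. f' x 1)" using f'(2) by blast
  then show "continuous_on S (deriv f)"
    by (subst continuous_on_cong[OF refl eq[symmetric]]) auto
qed

text \<open>The derivative in the definition of \<open>Ck_on\<close> is determined on \<open>S\<close> only, so \<open>deriv f\<close> agrees with it
  near a point only when \<open>S\<close> is a neighbourhood of that point.\<close>
lemma Ck_on_2_real:
  fixes f :: "real \<Rightarrow> real"
  assumes "Ck_on 2 f S" "x \<in> S"
  shows "(f has_real_derivative deriv f x) (at x)"
    and "open S \<Longrightarrow> (deriv f has_real_derivative deriv (deriv f) x) (at x)"
proof -
  obtain f' where f': "\<forall>x\<in>S. (f has_derivative f' x) (at x)" "\<forall>v. Ck_on 1 (\<lambda>x. f' x v) S"
    using assms(1) unfolding numeral_2_eq_2 One_nat_def Ck_on.simps(2)[of "Suc 0"] by blast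
  have *: "(f has_real_derivative f' x 1) (at x)" if "x \<in> S" for x
    using f'(1) that
    by (metis has_derivative_imp_has_field_derivative linear_scale_real has_derivative_linear mult.commute mult.right_neutral)
  then have eq: "f' x 1 = deriv f x" if "x \<in> S" for x
    using DERIV_imp_deriv[OF *[OF that]] by simp
  show "(f has_real_derivative deriv f x) (at x)"
    using * eq assms(2) by metis
  assume "open S"
  have "((\<lambda>x. f' x 1) has_real_derivative deriv (\<lambda>x. f' x 1) x) (at x)"
    using Ck_on_1_real(1) f'(2) assms(2) by blast
  then have "(deriv f has_real_derivative deriv (\<lambda>x. f' x 1) x) (at x)"
    by (rule has_field_derivative_transform_within_open[OF _ \<open>open S\<close> assms(2)]) (simp add: eq)
  then show "(deriv f has_real_derivative deriv (deriv f) x) (at x)"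
    by (metis DERIV_imp_deriv)
qed

lemma pd_eq_derivative:
  assumes "(f has_derivative D) (at y)"
  shows "pd i f y = D (axis i 1)"
proof -
  have 1: "((\<lambda>s::real. y + s *\<^sub>R axis i 1) has_derivative (\<lambda>s. s *\<^sub>R axis i 1)) (at 0)"
    by (auto intro!: derivative_eq_intros)
  have "((\<lambda>s. f (y + s *\<^sub>R axis i 1)) has_derivative (\<lambda>s. D (s *\<^sub>R axis i 1))) (at 0)"
    by (rule has_derivative_compose[OF 1]) (simp add: assms)
  then have "((\<lambda>s. f (y + s *\<^sub>R axis i 1)) has_real_derivative D (axis i 1)) (at 0)"
    by (rule has_derivative_imp_has_field_derivative)
      (metis has_derivative_linear[OF assms] linear_scale_real mult.commute scaleR_conv_of_real linear_scale real_scaleR_def)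
  then show ?thesis unfolding pd_def by (rule DERIV_imp_deriv)
qed

lemma linear_as_sum_axis:
  fixes D :: "real ^ 'n::finite \<Rightarrow> real"
  assumes "linear D"
  shows "(\<Sum>i\<in>UNIV. v $ i * D (axis i 1)) = D v"
proof -
  have "v = (\<Sum>i\<in>UNIV. v $ i *\<^sub>R axis i 1)"
    using basis_expansion[of v] by (simp add: scalar_mult_eq_scaleR)
  then have "D v = D (\<Sum>i\<in>UNIV. v $ i *\<^sub>R axis i 1)" by simp
  also have "\<dots> = (\<Sum>i\<in>UNIV. v $ i * D (axis i 1))"
    by (simp add: linear_sum[OF assms] linear_scale[OF assms])
  finally show ?thesis by simp
qed

text \<open>Both expressions of the metric tensor are combinations of the squares of three covectors; evaluating their
  quadratic forms on suitable vectors isolates one coefficient at a time.\<close>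
lemma quadratic_form_of_products:
  fixes G :: "real ^ 'n ^ 'n::finite"
  assumes "\<And>i j. G $ i $ j = a (axis i 1) * a (axis j 1) + p * (b (axis i 1) * b (axis j 1))
      + q * (c (axis i 1) * c (axis j 1))"
    and "linear a" "linear b" "linear c"
  shows "v \<bullet> (G *v v) = (a v)\<^sup>2 + p * (b v)\<^sup>2 + q * (c v)\<^sup>2"
proof -
  have "v \<bullet> (G *v v) = (\<Sum>i\<in>UNIV. \<Sum>j\<in>UNIV. v $ i * (G $ i $ j * v $ j))"
    by (simp add: inner_vec_def matrix_vector_mult_def sum_distrib_left)
  also have "\<dots> = (\<Sum>i\<in>UNIV. \<Sum>j\<in>UNIV. (v $ i * a (axis i 1)) * (v $ j * a (axis j 1))
      + p * ((v $ i * b (axis i 1)) * (v $ j * b (axis j 1)))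
      + q * ((v $ i * c (axis i 1)) * (v $ j * c (axis j 1))))"
    by (simp add: assms(1) algebra_simps)
  also have "\<dots> = (a v)\<^sup>2 + p * (b v)\<^sup>2 + q * (c v)\<^sup>2"
    by (simp only: sum.distrib sum_distrib_left[symmetric] linear_as_sum_axis[OF assms(2)]
        linear_as_sum_axis[OF assms(3)] linear_as_sum_axis[OF assms(4)]
        sum_distrib_right[symmetric] power2_eq_square)
  finally show ?thesis .
qed

section \<open>The ordinary differential equations of the characteristic functions\<close>

text \<open>The graph lies below each tangent line, and a tangent line of nonzero slope meets the axis.\<close>
lemma positive_concave_imp_constant:
  fixes h h' h'' :: "real \<Rightarrow> real"
  assumes "\<And>t. (h has_real_derivative h' t) (at t)"
    and "\<And>t. (h' has_real_derivative h'' t) (at t)"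
    and "\<And>t. 0 < h t" and "\<And>t. h'' t \<le> 0"
  shows "h' t = 0"
proof (rule ccontr)
  assume "h' t \<noteq> 0"
  have "convex_on UNIV (\<lambda>t. - h t)"
    by (rule f''_ge0_imp_convex[where f' = "\<lambda>t. - h' t" and f'' = "\<lambda>t. - h'' t"])
      (auto intro!: derivative_eq_intros assms simp: assms)
  then have "- h' t * (s - t) \<le> - h s - (- h t)" for s
    by (rule convex_on_imp_above_tangent) (auto intro!: derivative_eq_intros assms)
  from this[of "t - h t / h' t"] have "h (t - h t / h' t) \<le> 0"
    using \<open>h' t \<noteq> 0\<close> by simp
  then show False using assms(3)[of "t - h t / h' t"] by simp
qed

lemma L17_alt: "L17 C H \<theta> = H1 H * (sin \<theta>)\<^sup>2 + P1 C"
  unfolding L17_def H1_def P1_def cos_squared_eq by (simp add: algebra_simps)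

lemma H2_alt: "H2 C H = H1 H + P1 C"
  by (simp add: H2_def H1_def P1_def)

text \<open>For \<open>C = H = 1\<close> the radical vanishes identically and \<open>sqrt\<close> cannot be differentiated through
  it. The formulas below are written with \<open>H1 H\<close> or \<open>P1 C\<close> over \<open>sqrt (L17 C H \<theta>)\<close>; in the
  degenerate case these numerators vanish, so the formulas cover it as well.\<close>
lemma L17_positive_or_degenerate:
  assumes "1 \<le> C" "0 < H" "H \<le> 1" "sin \<theta> \<noteq> 0"
  shows "0 < L17 C H \<theta> \<or> (\<forall>\<alpha>. L17 C H \<alpha> = 0) \<and> H1 H = 0 \<and> P1 C = 0"
proof -
  have "H1 H \<ge> 0" "P1 C \<ge> 0"
    using assms by (auto simp: H1_def P1_def power_le_one)
  moreover have "(sin \<theta>)\<^sup>2 > 0" using assms by simp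
  ultimately show ?thesis unfolding L17_alt
    by (cases "H1 H = 0"; cases "P1 C = 0") (auto intro: add_pos_nonneg add_nonneg_pos)
qed

context
  fixes C H \<theta> :: real
  assumes C: "1 \<le> C" and H: "0 < H" "H \<le> 1" and s: "sin \<theta> \<noteq> 0"
begin

lemma H1_P1_nonneg: "H1 H \<ge> 0" "P1 C \<ge> 0"
  using C H by (auto simp: H1_def P1_def power_le_one)

lemma R17_derivative:
  "(R17 C H has_real_derivative - sin \<theta> + H1 H * sin \<theta> * cos \<theta> / sqrt (L17 C H \<theta>)) (at \<theta>)"
  using L17_positive_or_degenerate[OF C H s]
proof
  assume L: "0 < L17 C H \<theta>"
  have "(L17 C H has_real_derivative 2 * (H1 H * sin \<theta> * cos \<theta>)) (at \<theta>)"
    unfolding L17_alt[abs_def] by (auto intro!: derivative_eq_intros)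
  then have "((\<lambda>\<theta>. sqrt (L17 C H \<theta>)) has_real_derivative H1 H * sin \<theta> * cos \<theta> / sqrt (L17 C H \<theta>)) (at \<theta>)"
    using L by (auto intro!: derivative_eq_intros simp: field_simps)
  from DERIV_add[OF DERIV_cos this] show ?thesis unfolding R17_def[abs_def] .
next
  assume "(\<forall>\<alpha>. L17 C H \<alpha> = 0) \<and> H1 H = 0 \<and> P1 C = 0"
  then show ?thesis unfolding R17_def[abs_def] by (auto intro!: derivative_eq_intros)
qed

text \<open>The chain rule applies because \<open>1 - (H1 / H2) cos\<^sup>2 \<theta> = L17 / H2\<close> is positive.\<close>
lemma I_exp_derivative:
  "(I_exp C H has_real_derivative I_exp C H \<theta> * (H1 H * sin \<theta> / sqrt (L17 C H \<theta>))) (at \<theta>)"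
proof (cases "H1 H = 0")
  case True
  then show ?thesis by (simp add: I_exp_def[abs_def])
next
  case False
  then have H1: "H1 H > 0" using H1_P1_nonneg by simp
  then have H2: "H2 C H > 0" using H1_P1_nonneg by (simp add: H2_alt)
  have L: "L17 C H \<theta> > 0"
    using L17_positive_or_degenerate[OF C H s] False by auto
  define k where "k = sqrt (H1 H / H2 C H)"
  have k2: "k\<^sup>2 = H1 H / H2 C H" using H1 H2 by (simp add: k_def)
  have *: "1 - (k * cos \<theta>)\<^sup>2 = L17 C H \<theta> / H2 C H"
    using H2 by (simp add: power_mult_distrib k2 L17_alt H2_alt cos_squared_eq field_simps)
  then have "(k * cos \<theta>)\<^sup>2 < 1" using divide_pos_pos[OF L H2] by linarith
  then have b: "- 1 < k * cos \<theta>" "k * cos \<theta> < 1"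
    by (auto simp: abs_square_less_1)
  have darc: "((\<lambda>\<theta>. arcsin (k * cos \<theta>)) has_real_derivative
     - (k * sin \<theta>) * inverse (sqrt (L17 C H \<theta> / H2 C H))) (at \<theta>)"
    unfolding *[symmetric]
    by (rule derivative_eq_intros b refl)+ (simp add: mult.commute)
  have e: "sqrt (H1 H) * k * inverse (sqrt (L17 C H \<theta> / H2 C H)) = H1 H / sqrt (L17 C H \<theta>)"
    using H1 H2 L by (simp add: k_def real_sqrt_divide field_simps)
  have "((\<lambda>\<theta>. exp (- sqrt (H1 H) * arcsin (k * cos \<theta>))) has_real_derivative
      exp (- sqrt (H1 H) * arcsin (k * cos \<theta>)) *
      (- sqrt (H1 H) * (- (k * sin \<theta>) * inverse (sqrt (L17 C H \<theta> / H2 C H))))) (at \<theta>)"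
    by (intro DERIV_fun_exp DERIV_cmult darc)
  moreover have "- sqrt (H1 H) * (- (k * sin \<theta>) * inverse (sqrt (L17 C H \<theta> / H2 C H)))
      = H1 H * sin \<theta> / sqrt (L17 C H \<theta>)"
    using arg_cong[OF e, of "\<lambda>z. z * sin \<theta>"] by (simp add: mult_ac)
  ultimately show ?thesis unfolding I_exp_def[abs_def] k_def[symmetric] by simp
qed

text \<open>\<open>Y = A\<^sup>2\<close> where \<open>ln \<bar>A\<bar>\<close> is the area hyperbolic sine of
  \<open>sqrt P1 cos \<theta> / (sqrt H2 \<bar>sin \<theta>\<bar>)\<close>; hence the logarithmic derivative of \<open>A\<close> is
  \<open>- sqrt P1 / (sin \<theta> sqrt L17)\<close>.\<close>
lemma Y1_pos_and_derivative:
  "0 < Y1 C H \<theta>"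
  "(Y1 C H has_real_derivative Y1 C H \<theta> * (- P1 C / (sin \<theta> * sqrt (L17 C H \<theta>)))) (at \<theta>)"
proof -
  have "0 < Y1 C H \<theta> \<and> (Y1 C H has_real_derivative Y1 C H \<theta> * (- P1 C / (sin \<theta> * sqrt (L17 C H \<theta>)))) (at \<theta>)"
  proof (cases "P1 C = 0")
    case True
    then show ?thesis by (simp add: Y1_def[abs_def])
  next
    case False
    then have P: "P1 C > 0" using H1_P1_nonneg by simp
    then have H2: "H2 C H > 0" using H1_P1_nonneg by (simp add: H2_alt)
    have L: "L17 C H \<theta> > 0"
      using L17_positive_or_degenerate[OF C H s] False by auto
    define q r l where "q = sqrt (P1 C)" and "r = sqrt (H2 C H)" and "l = sqrt (L17 C H \<theta>)"
    have pos: "q > 0" "r > 0" "l > 0" using P H2 L by (auto simp: q_def r_def l_def)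
    have q2: "q\<^sup>2 = P1 C" and l2: "l\<^sup>2 = H1 H * (sin \<theta>)\<^sup>2 + q\<^sup>2"
      using P L by (auto simp: q_def l_def L17_alt)
    define A where "A = (\<lambda>\<theta>. 1 / (r * sin \<theta>) * (sqrt (L17 C H \<theta>) + q * cos \<theta>))"
    have YA: "Y C H = (\<lambda>\<theta>. (A \<theta>)\<^sup>2)" by (simp add: Y_def[abs_def] A_def r_def q_def)
    \<comment> \<open>A zero of \<open>A\<close> would give \<open>L17 = P1 cos\<^sup>2 \<theta>\<close>, but \<open>L17 - P1 cos\<^sup>2 \<theta> = H2 sin\<^sup>2 \<theta> > 0\<close>.\<close>
    have A0: "A \<theta> \<noteq> 0"
    proof
      assume "A \<theta> = 0"
      then have "l = - (q * cos \<theta>)" using pos s by (auto simp: A_def l_def[symmetric])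
      then have "l\<^sup>2 = q\<^sup>2 * (1 - (sin \<theta>)\<^sup>2)" by (simp add: power_mult_distrib cos_squared_eq)
      then have "(H1 H + q\<^sup>2) * (sin \<theta>)\<^sup>2 = 0" using l2 by (simp add: algebra_simps)
      then show False using s H2 by (simp add: H2_alt q2)
    qed
    have "(L17 C H has_real_derivative 2 * (H1 H * sin \<theta> * cos \<theta>)) (at \<theta>)"
      unfolding L17_alt[abs_def] by (auto intro!: derivative_eq_intros)
    then have "((\<lambda>\<theta>. sqrt (L17 C H \<theta>)) has_real_derivative H1 H * sin \<theta> * cos \<theta> / l) (at \<theta>)"
      using L by (auto intro!: derivative_eq_intros simp: field_simps l_def)
    note [derivative_intros] = this
    have "(A has_real_derivative - (r * cos \<theta>) / (r * sin \<theta>)\<^sup>2 * (l + q * cos \<theta>)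
       + 1 / (r * sin \<theta>) * (H1 H * sin \<theta> * cos \<theta> / l - q * sin \<theta>)) (at \<theta>)"
      unfolding A_def using s pos
      by (auto intro!: derivative_eq_intros simp: l_def[symmetric] power2_eq_square diff_divide_distrib)
    moreover have "- (r * cos \<theta>) / (r * sin \<theta>)\<^sup>2 * (l + q * cos \<theta>)
       + 1 / (r * sin \<theta>) * (H1 H * sin \<theta> * cos \<theta> / l - q * sin \<theta>) = - q / (sin \<theta> * l) * A \<theta>"
    proof -
      have c2: "(cos \<theta>)\<^sup>2 = 1 - (sin \<theta>)\<^sup>2" by (rule cos_squared_eq)
      have "- cos \<theta> * (l + q * cos \<theta>) * l + sin \<theta> * (H1 H * sin \<theta> * cos \<theta> - q * sin \<theta> * l)
         = - q * (l + q * cos \<theta>)"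
        using l2 c2 by algebra
      then show ?thesis
        unfolding A_def l_def[symmetric] using s pos
        by (simp add: divide_simps power2_eq_square) algebra
    qed
    ultimately have "(A has_real_derivative - q / (sin \<theta> * l) * A \<theta>) (at \<theta>)" by simp
    then have "(Y C H has_real_derivative 2 * (A \<theta> * (- q / (sin \<theta> * l) * A \<theta>))) (at \<theta>)"
      unfolding YA by (auto intro!: derivative_eq_intros)
    then have dY: "(Y C H has_real_derivative Y C H \<theta> * (- 2 * q / (sin \<theta> * l))) (at \<theta>)"
      by (rule DERIV_cong) (simp add: YA power2_eq_square field_simps)
    have Y: "Y C H \<theta> > 0" using A0 by (simp add: YA)
    have Y1: "Y1 C H = (\<lambda>\<theta>. Y C H \<theta> powr (q / 2))" using False by (simp add: Y1_def[abs_def] q_def)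
    have "((\<lambda>\<theta>. Y C H \<theta> powr (q / 2)) has_real_derivative
       Y C H \<theta> powr (q / 2) * (0 * ln (Y C H \<theta>) + Y C H \<theta> * (- 2 * q / (sin \<theta> * l)) * (q / 2) / Y C H \<theta>)) (at \<theta>)"
      by (rule DERIV_powr[OF dY Y]) simp
    moreover have "0 * ln (Y C H \<theta>) + Y C H \<theta> * (- 2 * q / (sin \<theta> * l)) * (q / 2) / Y C H \<theta> = - P1 C / (sin \<theta> * l)"
      using Y by (simp add: q2[symmetric] power2_eq_square)
    ultimately have "((\<lambda>\<theta>. Y C H \<theta> powr (q / 2)) has_real_derivative
       Y C H \<theta> powr (q / 2) * (- P1 C / (sin \<theta> * l))) (at \<theta>)" by (simp only:)
    then show ?thesis using Y unfolding Y1 l_def by simp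
  qed
  then show "0 < Y1 C H \<theta>"
    "(Y1 C H has_real_derivative Y1 C H \<theta> * (- P1 C / (sin \<theta> * sqrt (L17 C H \<theta>)))) (at \<theta>)" by auto
qed

text \<open>These are the two cancellations behind the explicit solution. The first expresses that
  \<open>R17 / I\<close> has logarithmic derivative \<open>- sin \<theta> / (H\<^sup>2 R17)\<close>, which balances that of \<open>U\<close>;
  the second that \<open>R17 / (sin \<theta> Y1)\<close> has logarithmic derivative \<open>- 1 / (C sin \<theta> R17)\<close>, which
  balances that of \<open>f\<close>.\<close>
lemma R17_derivative_identities:
  shows "- sin \<theta> + H1 H * sin \<theta> * cos \<theta> / sqrt (L17 C H \<theta>)
      = R17 C H \<theta> * (H1 H * sin \<theta> / sqrt (L17 C H \<theta>)) - sin \<theta> / H\<^sup>2"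
    and "(- sin \<theta> + H1 H * sin \<theta> * cos \<theta> / sqrt (L17 C H \<theta>)) * sin \<theta> - R17 C H \<theta> * cos \<theta>
      + R17 C H \<theta> * P1 C / sqrt (L17 C H \<theta>) = - 1 / C"
proof -
  define l where "l = sqrt (L17 C H \<theta>)"
  have R: "R17 C H \<theta> = cos \<theta> + l" by (simp add: R17_def l_def)
  have HH: "1 / H\<^sup>2 = 1 + H1 H" and PP: "1 / C = 1 - P1 C" by (simp_all add: H1_def P1_def)
  have c2: "(cos \<theta>)\<^sup>2 = 1 - (sin \<theta>)\<^sup>2" by (rule cos_squared_eq)
  have "l > 0 \<and> l\<^sup>2 = H1 H * (sin \<theta>)\<^sup>2 + P1 C \<or> l = 0 \<and> H1 H = 0 \<and> P1 C = 0"
    using L17_positive_or_degenerate[OF C H s] by (auto simp: l_def L17_alt)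
  then have "(- sin \<theta> + H1 H * sin \<theta> * cos \<theta> / l = (cos \<theta> + l) * (H1 H * sin \<theta> / l) - sin \<theta> * (1 + H1 H)) \<and>
     (- sin \<theta> + H1 H * sin \<theta> * cos \<theta> / l) * sin \<theta> - (cos \<theta> + l) * cos \<theta> + (cos \<theta> + l) * P1 C / l = - (1 - P1 C)"
  proof (elim disjE conjE)
    assume l: "l > 0" "l\<^sup>2 = H1 H * (sin \<theta>)\<^sup>2 + P1 C"
    have "(- sin \<theta> * l + H1 H * sin \<theta> * cos \<theta>) * sin \<theta> - (cos \<theta> + l) * cos \<theta> * l + (cos \<theta> + l) * P1 C = - (1 - P1 C) * l"
      using l(2) c2 by algebra
    then have "((- sin \<theta> * l + H1 H * sin \<theta> * cos \<theta>) * sin \<theta> - (cos \<theta> + l) * cos \<theta> * l + (cos \<theta> + l) * P1 C) / l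
        = - (1 - P1 C)" using l(1) by simp
    moreover have "((- sin \<theta> * l + H1 H * sin \<theta> * cos \<theta>) * sin \<theta> - (cos \<theta> + l) * cos \<theta> * l + (cos \<theta> + l) * P1 C) / l
       = (- sin \<theta> + H1 H * sin \<theta> * cos \<theta> / l) * sin \<theta> - (cos \<theta> + l) * cos \<theta> + (cos \<theta> + l) * P1 C / l"
      using l(1) by (simp add: field_simps)
    ultimately have "(- sin \<theta> + H1 H * sin \<theta> * cos \<theta> / l) * sin \<theta> - (cos \<theta> + l) * cos \<theta> + (cos \<theta> + l) * P1 C / l
      = - (1 - P1 C)" by (simp only:)
    moreover have "- sin \<theta> + H1 H * sin \<theta> * cos \<theta> / l = (cos \<theta> + l) * (H1 H * sin \<theta> / l) - sin \<theta> * (1 + H1 H)"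
      using l(1) by (simp add: field_simps)
    ultimately show ?thesis by (simp only: simp_thms)
  next
    assume "l = 0" "H1 H = 0" "P1 C = 0"
    then show ?thesis using c2 by (simp add: power2_eq_square)
  qed
  then show "- sin \<theta> + H1 H * sin \<theta> * cos \<theta> / sqrt (L17 C H \<theta>)
      = R17 C H \<theta> * (H1 H * sin \<theta> / sqrt (L17 C H \<theta>)) - sin \<theta> / H\<^sup>2"
    "(- sin \<theta> + H1 H * sin \<theta> * cos \<theta> / sqrt (L17 C H \<theta>)) * sin \<theta> - R17 C H \<theta> * cos \<theta>
      + R17 C H \<theta> * P1 C / sqrt (L17 C H \<theta>) = - 1 / C"
    unfolding l_def[symmetric] R using HH PP by (metis times_divide_eq_right mult.right_neutral, metis minus_divide_left)
qed

end

lemma integrated_characteristic_equations: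
  fixes U \<theta> :: "real \<Rightarrow> real"
  assumes C: "1 \<le> C" and H: "0 < H" "H \<le> 1"
    and S: "convex S" "\<And>f. f \<in> S \<Longrightarrow> f \<noteq> 0"
    and s: "\<And>f. f \<in> S \<Longrightarrow> sin (\<theta> f) \<noteq> 0"
    and R: "\<And>f. f \<in> S \<Longrightarrow> R17 C H (\<theta> f) \<noteq> 0"
    and d\<theta>: "\<And>f. f \<in> S \<Longrightarrow> (\<theta> has_real_derivative C * sin (\<theta> f) * R17 C H (\<theta> f) / f) (at f)"
    and dU: "\<And>f. f \<in> S \<Longrightarrow> (U has_real_derivative U f * (C / H\<^sup>2 * (sin (\<theta> f))\<^sup>2) / f) (at f)"
  obtains C22 C33 where
    "\<And>f. f \<in> S \<Longrightarrow> U f = C22 * (1 / R17 C H (\<theta> f)) * I_exp C H (\<theta> f)"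
    "\<And>f. f \<in> S \<Longrightarrow> f = C33 * (sin (\<theta> f) / R17 C H (\<theta> f)) * Y1 C H (\<theta> f)"
proof -
  have "((\<lambda>f. U f * R17 C H (\<theta> f) / I_exp C H (\<theta> f)) has_real_derivative 0) (at f within S)" if f: "f \<in> S" for f
  proof -
    note [derivative_intros] = dU[OF f] DERIV_chain2[OF R17_derivative[OF C H s[OF f]] d\<theta>[OF f]]
      DERIV_chain2[OF I_exp_derivative[OF C H s[OF f]] d\<theta>[OF f]]
    have I: "I_exp C H (\<theta> f) \<noteq> 0" by (simp add: I_exp_def)
    show ?thesis
      apply (rule has_field_derivative_at_within)
      apply (rule derivative_eq_intros I refl)+
      unfolding R17_derivative_identities(1)[OF C H s[OF f]]
      using I S(2)[OF f] by (simp add: divide_simps) (simp add: algebra_simps power2_eq_square)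
  qed
  then obtain a where a: "\<And>f. f \<in> S \<Longrightarrow> U f * R17 C H (\<theta> f) / I_exp C H (\<theta> f) = a"
    using has_field_derivative_zero_constant[OF S(1), of "\<lambda>f. U f * R17 C H (\<theta> f) / I_exp C H (\<theta> f)"] by blast
  have "((\<lambda>f. f * R17 C H (\<theta> f) / (sin (\<theta> f) * Y1 C H (\<theta> f))) has_real_derivative 0) (at f within S)" if f: "f \<in> S" for f
  proof -
    note Y1p = Y1_pos_and_derivative(1)[OF C H s[OF f]]
    note [derivative_intros] = DERIV_chain2[OF R17_derivative[OF C H s[OF f]] d\<theta>[OF f]]
      DERIV_chain2[OF Y1_pos_and_derivative(2)[OF C H s[OF f]] d\<theta>[OF f]] d\<theta>[OF f]
    have ne: "sin (\<theta> f) * Y1 C H (\<theta> f) \<noteq> 0" using Y1p s[OF f] by simp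
    define r l S1 Y2 R1 k where "r = R17 C H (\<theta> f)" and "l = sqrt (L17 C H (\<theta> f))" and "S1 = sin (\<theta> f)" and "Y2 = Y1 C H (\<theta> f)"
     and "R1 = - sin (\<theta> f) + H1 H * sin (\<theta> f) * cos (\<theta> f) / sqrt (L17 C H (\<theta> f))" and "k = P1 C / l"
    have e: "R1 * S1 - r * cos (\<theta> f) + r * k = - 1 / C"
      using R17_derivative_identities(2)[OF C H s[OF f]] by (simp add: r_def l_def S1_def R1_def k_def)
    have nz: "S1 \<noteq> 0" "Y2 \<noteq> 0" "f \<noteq> 0" "C \<noteq> 0" using s[OF f] Y1p S(2)[OF f] C by (auto simp: S1_def Y2_def)
    have "((\<lambda>f. f * R17 C H (\<theta> f) / (sin (\<theta> f) * Y1 C H (\<theta> f))) has_real_derivative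
       ((r + R1 * (C * S1 * r / f) * f) * (S1 * Y2) - f * r * (C * S1 * r / f * cos (\<theta> f) * Y2 + (Y2 * (- P1 C / (S1 * l)) * (C * S1 * r / f)) * S1))
        / ((S1 * Y2) * (S1 * Y2))) (at f)"
      unfolding r_def l_def S1_def Y2_def R1_def
      by (rule derivative_eq_intros ne refl)+ (simp add: algebra_simps)
    moreover have "(r + R1 * (C * S1 * r / f) * f) * (S1 * Y2) - f * r * (C * S1 * r / f * cos (\<theta> f) * Y2 + (Y2 * (- P1 C / (S1 * l)) * (C * S1 * r / f)) * S1)
       = r * S1 * Y2 * C * (1 / C + (R1 * S1 - r * cos (\<theta> f) + r * k))"
      using nz by (simp add: k_def field_simps)
    ultimately show ?thesis unfolding e
      by (auto intro: has_field_derivative_at_within)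
  qed
  then obtain b where b: "\<And>f. f \<in> S \<Longrightarrow> f * R17 C H (\<theta> f) / (sin (\<theta> f) * Y1 C H (\<theta> f)) = b"
    using has_field_derivative_zero_constant[OF S(1), of "\<lambda>f. f * R17 C H (\<theta> f) / (sin (\<theta> f) * Y1 C H (\<theta> f))"] by blast
  show ?thesis
  proof
    fix f assume f: "f \<in> S"
    show "U f = a * (1 / R17 C H (\<theta> f)) * I_exp C H (\<theta> f)"
      using R[OF f] by (simp add: a[OF f, symmetric] I_exp_def)
    show "f = b * (sin (\<theta> f) / R17 C H (\<theta> f)) * Y1 C H (\<theta> f)"
      using R[OF f] s[OF f] Y1_pos_and_derivative(1)[OF C H s[OF f]] by (simp add: b[OF f, symmetric])
  qed
qed

text \<open>Here \<open>u\<close> stands for \<open>ln \<bar>f\<bar>\<close> and \<open>g\<close> for \<open>\<theta>\<close>. If \<open>C < 1\<close>, then \<open>P1 < 0\<close>, so \<open>L17 \<ge> 0\<close> bounds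
  \<open>sin\<^sup>2 g\<close> from below. The derivative of \<open>cos g\<close> is \<open>- p sin\<^sup>2 g\<close>, of constant sign, so going back
  in \<open>u\<close> moves \<open>cos g\<close> monotonically away from the only value
  at which \<open>p = C (cos g + sqrt L17)\<close> can vanish. Thus \<open>\<bar>p\<bar>\<close> is bounded below for \<open>u \<le> 0\<close>
  and the bounded function \<open>cos g\<close> would have to change by arbitrarily large amounts.\<close>
lemma full_angle_range_imp_C_ge_1:
  fixes g p :: "real \<Rightarrow> real"
  assumes C: "0 < C"
    and dg: "\<And>u. (g has_real_derivative p u * sin (g u)) (at u)"
    and p0: "\<And>u. p u \<noteq> 0" and cont: "continuous_on UNIV p"
    and quad: "\<And>u. (p u - C * cos (g u))\<^sup>2 = C\<^sup>2 * L17 C H (g u)"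
    and oriented: "\<And>u. C * cos (g u) \<le> p u"
  shows "1 \<le> C"
proof (rule ccontr)
  assume "\<not> 1 \<le> C"
  then have P: "P1 C < 0" using C by (simp add: P1_def)
  define c where "c = (\<lambda>u. cos (g u))"
  define L where "L = (\<lambda>u. L17 C H (g u))"
  have L: "L u = H1 H * (1 - (c u)\<^sup>2) + P1 C" for u
    by (simp add: L_def c_def L17_alt sin_squared_eq)
  have L0: "L u \<ge> 0" for u
    using zero_le_power2[of "p u - C * cos (g u)"] C unfolding quad L_def
    by (simp add: zero_le_mult_iff)
  have p: "p u = C * (c u + sqrt (L u))" for u
  proof -
    have "p u - C * c u = sqrt (C\<^sup>2 * L u)"
      using oriented[of u] quad[of u] by (metis L_def c_def diff_ge_0_iff_ge real_sqrt_unique)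
    then show ?thesis using C by (simp add: real_sqrt_mult algebra_simps)
  qed
  have c1: "(c u)\<^sup>2 \<le> 1" for u by (simp add: c_def abs_square_le_1)
  have H1: "H1 H > 0"
    using L0[of 0] L[of 0] P c1[of 0] mult_nonpos_nonneg[of "H1 H" "1 - (c 0)\<^sup>2"] by linarith
  define \<delta> where "\<delta> = - P1 C / H1 H"
  have \<delta>: "\<delta> > 0" "\<delta> \<le> 1 - (c u)\<^sup>2" for u
    using L0[of u] P H1 by (auto simp: \<delta>_def L field_simps)
  have dc: "(c has_real_derivative - p u * (1 - (c u)\<^sup>2)) (at u)" for u
    unfolding c_def sin_squared_eq[symmetric]
    by (auto intro!: derivative_eq_intros dg simp: power2_eq_square)
  have sign: "sgn (p u) = sgn (p 0)" for u
  proof (rule ccontr)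
    assume "sgn (p u) \<noteq> sgn (p 0)"
    then have "p u < 0 \<and> 0 < p 0 \<or> p 0 < 0 \<and> 0 < p u"
      using p0[of u] p0[of 0] by (auto simp: sgn_real_def split: if_splits)
    moreover have "connected (range p)" using cont by (intro connected_continuous_image connected_UNIV)
    ultimately have "0 \<in> range p" unfolding connected_iff_interval by (metis less_imp_le rangeI)
    then show False using p0 by (metis imageE)
  qed
  have "\<exists>\<epsilon>>0. \<forall>u\<le>0. \<epsilon> \<le> \<bar>p u\<bar>"
  proof (cases "p 0 > 0")
    case True
    then have pp: "p u > 0" for u using sign[of u] by (auto simp: sgn_real_def split: if_splits)
    have H2: "H1 H * (c u)\<^sup>2 \<le> H2 C H" for u
      using L0[of u] by (simp add: L H2_alt algebra_simps)
    have "H2 C H \<noteq> 0"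
    proof
      assume "H2 C H = 0"
      then have "c = (\<lambda>u. 0)" using H2 H1 by (auto simp: mult_le_0_iff fun_eq_iff)
      then have "- p 0 * (1 - (c 0)\<^sup>2) = 0" using dc[of 0] by (metis DERIV_const DERIV_unique)
      then show False using \<delta>(1) \<delta>(2)[of 0] p0[of 0] by auto
    qed
    moreover have "H2 C H \<ge> 0" using H2[of 0] mult_nonneg_nonneg[OF less_imp_le[OF H1] zero_le_power2[of "c 0"]] by linarith
    ultimately have H2p: "H2 C H > 0" by simp
    define m where "m = min (H2 C H) (H2 C H / H1 H)"
    have m: "m > 0" using H1 H2p by (simp add: m_def)
    \<comment> \<open>\<open>(c u)\<^sup>2 + L u\<close> is affine in \<open>(c u)\<^sup>2\<close>, which ranges between \<open>0\<close> and \<open>H2 / H1\<close>; the values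
      at these two ends are \<open>H2\<close> and \<open>H2 / H1\<close>.\<close>
    have mm: "m \<le> (c u)\<^sup>2 + L u" for u
    proof -
      have e: "(c u)\<^sup>2 + L u = H2 C H + (1 - H1 H) * (c u)\<^sup>2" by (simp add: L H2_alt algebra_simps)
      show ?thesis
      proof (cases "H1 H \<le> 1")
        case True
        then have "0 \<le> (1 - H1 H) * (c u)\<^sup>2" by simp
        then show ?thesis unfolding e m_def by simp
      next
        case False
        have "(c u)\<^sup>2 \<le> H2 C H / H1 H" using H2[of u] H1 by (simp add: field_simps)
        then have "(1 - H1 H) * (H2 C H / H1 H) \<le> (1 - H1 H) * (c u)\<^sup>2"
          using False by (intro mult_left_mono_neg) auto
        then have "H2 C H / H1 H \<le> H2 C H + (1 - H1 H) * (c u)\<^sup>2" using H1 by (simp add: field_simps)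
        then show ?thesis unfolding e m_def by simp
      qed
    qed
    have "min (p 0) (C * sqrt m) \<le> p u" if u: "u \<le> 0" for u
    proof (cases "c u \<ge> 0")
      case True
      have "(c u)\<^sup>2 + L u \<le> (c u + sqrt (L u))\<^sup>2"
        using True L0[of u] by (simp add: power2_sum)
      then have "sqrt m \<le> c u + sqrt (L u)"
        using mm[of u] True L0[of u] by (intro real_le_lsqrt) auto
      then show ?thesis using C by (simp add: p min.coboundedI2)
    next
      case False
      have "c 0 \<le> c u"
        using u by (rule DERIV_nonpos_imp_nonincreasing)
          (use dc pp \<delta> in \<open>force intro!: mult_nonneg_nonneg less_imp_le[OF pp] simp: c1\<close>)
      then have "L 0 \<le> L u" using H1 False by (simp add: L abs_le_square_iff[symmetric])
      then have "p 0 \<le> p u" using \<open>c 0 \<le> c u\<close> C by (simp add: p add_mono)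
      then show ?thesis by simp
    qed
    then show ?thesis using True C m pp by (intro exI[of _ "min (p 0) (C * sqrt m)"]) (auto simp: abs_of_pos)
  next
    case False
    then have pp: "p u < 0" for u using sign[of u] p0[of u] p0[of 0] by (auto simp: sgn_real_def split: if_splits)
    have cneg: "c u < 0" for u
    proof -
      have "c u + sqrt (L u) < 0" using pp[of u] C by (simp add: p mult_less_0_iff)
      then show ?thesis using real_sqrt_ge_zero[OF L0[of u]] by linarith
    qed
    have "p u \<le> p 0" if u: "u \<le> 0" for u
    proof -
      have "c u \<le> c 0"
        using u by (rule DERIV_nonneg_imp_nondecreasing)
          (use dc in \<open>force intro!: mult_nonpos_nonneg less_imp_le[OF pp] simp: c1\<close>)
      then have "L u \<le> L 0" using H1 cneg[of u] cneg[of 0] by (simp add: L abs_le_square_iff[symmetric])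
      then show ?thesis using \<open>c u \<le> c 0\<close> C by (simp add: p add_mono)
    qed
    then show ?thesis using pp[of 0] by (intro exI[of _ "- p 0"]) force
  qed
  then obtain \<epsilon> where \<epsilon>: "\<epsilon> > 0" "\<And>u. u \<le> 0 \<Longrightarrow> \<epsilon> \<le> \<bar>p u\<bar>" by auto
  \<comment> \<open>\<open>\<epsilon> * \<delta>\<close> bounds the rate of change from below; over a time \<open>N\<close> it produces a change of \<open>3\<close>,
    more than the width \<open>2\<close> of the range of \<open>cos\<close>.\<close>
  define N where "N = 3 / (\<epsilon> * \<delta>)"
  have N: "N > 0" using \<epsilon> \<delta> by (simp add: N_def)
  obtain \<xi> where \<xi>: "- N < \<xi>" "\<xi> < 0" "c 0 - c (- N) = (0 - - N) * (- p \<xi> * (1 - (c \<xi>)\<^sup>2))"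
    using MVT2[of "- N" 0 c "\<lambda>u. - p u * (1 - (c u)\<^sup>2)"] N dc by auto
  have "\<bar>c 0 - c (- N)\<bar> = N * (\<bar>p \<xi>\<bar> * (1 - (c \<xi>)\<^sup>2))"
    using N c1[of \<xi>] unfolding \<xi>(3) by (simp add: abs_mult)
  also have "\<dots> \<ge> N * (\<epsilon> * \<delta>)"
    using N \<epsilon> \<delta> \<xi> by (intro mult_left_mono mult_mono) auto
  finally have "3 \<le> \<bar>c 0 - c (- N)\<bar>" using \<epsilon> \<delta> by (simp add: N_def)
  moreover have "\<bar>c 0\<bar> \<le> 1" "\<bar>c (- N)\<bar> \<le> 1" by (auto simp: c_def)
  ultimately show False by linarith
qed

section \<open>The Hessian of a metric function of UZ form\<close>
context coframed_manifold3
begin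

lemma open_cone: "open (cone x)"
proof -
  have "cone x = {y. 0 < w2 x \<bullet> y} \<inter> {y. 0 < w3 x \<bullet> y}" by (auto simp: cone_def)
  moreover have "open {y. 0 < w2 x \<bullet> y}" "open {y. 0 < w3 x \<bullet> y}"
    by (intro open_Collect_less continuous_intros)+
  ultimately show ?thesis by auto
qed

text \<open>Independence lets a linear functional take any prescribed values on the three forms, and a
  linear functional is the inner product with a vector.\<close>
lemma exists_vector_with_components:
  obtains v where "w1 x \<bullet> v = a" "w2 x \<bullet> v = b" "w3 x \<bullet> v = c"
proof -
  define h where "h = (\<lambda>w. if w = w1 x then a else if w = w2 x then b else c)"
  obtain g where g: "linear g" "\<forall>w\<in>{w1 x, w2 x, w3 x}. g w = h w"
    using linear_independent_extend[OF forms_independent(2)] by blast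
  have "w \<bullet> adjoint g 1 = g w" for w
    using adjoint_works[OF g(1), of w 1] by simp
  then show ?thesis
    using that[of "adjoint g 1"] g(2) forms_independent(1)[of x] by (auto simp: h_def)
qed

lemma exists_cone_vector:
  assumes "0 < c"
  obtains y where "y \<in> cone x" "c2 x y = c" "t_of x y = t"
proof -
  obtain y where "w1 x \<bullet> y = t * c" "w2 x \<bullet> y = c" "w3 x \<bullet> y = 1"
    by (rule exists_vector_with_components)
  then show ?thesis using that[of y] assms by (auto simp: cone_def c2_def t_of_def)
qed

definition dt :: "'m \<Rightarrow> real ^ 3 \<Rightarrow> real ^ 3 \<Rightarrow> real" where
  "dt x y v = (w1 x \<bullet> v - t_of x y * (w2 x \<bullet> v)) / (w2 x \<bullet> y)"

lemma t_of_derivative: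
  assumes "y \<in> cone x"
  shows "(t_of x has_derivative dt x y) (at y)"
proof -
  have "w2 x \<bullet> y \<noteq> 0" using assms by (auto simp: cone_def)
  then show ?thesis
    unfolding t_of_def[abs_def] dt_def[abs_def]
    by (auto intro!: derivative_eq_intros simp: field_simps)
qed

end

context UZ_finsler_space
begin

definition f_of :: "'m \<Rightarrow> real ^ 3 \<Rightarrow> real" where
  "f_of x y = c2 x y * Zh x (t_of x y)"

definition df :: "'m \<Rightarrow> real ^ 3 \<Rightarrow> real ^ 3 \<Rightarrow> real" where
  "df x y v = (deriv (Zh x) (t_of x y) * (w1 x \<bullet> v - t_of x y * (w2 x \<bullet> v))
      + Zh x (t_of x y) * (w2 x \<bullet> v) - f_of x y * (w3 x \<bullet> v)) / (w3 x \<bullet> y)"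

definition dF :: "'m \<Rightarrow> real ^ 3 \<Rightarrow> real ^ 3 \<Rightarrow> real" where
  "dF x y v = (w3 x \<bullet> v) * Uh x (f_of x y) + (w3 x \<bullet> y) * deriv (Uh x) (f_of x y) * df x y v"

lemmas Zh_deriv = Ck_on_2_real(1)[OF Zh_smooth UNIV_I]
lemmas Zh_deriv2 = Ck_on_2_real(2)[OF Zh_smooth UNIV_I open_UNIV]

lemma Zh_t_of_derivative:
  assumes "y \<in> cone x"
  shows "((\<lambda>y. Zh x (t_of x y)) has_derivative (\<lambda>v. dt x y v * deriv (Zh x) (t_of x y))) (at y)"
    and "((\<lambda>y. deriv (Zh x) (t_of x y)) has_derivative
      (\<lambda>v. dt x y v * deriv (deriv (Zh x)) (t_of x y))) (at y)"
  by (rule DERIV_compose_FDERIV[OF _ t_of_derivative[OF assms]] Zh_deriv Zh_deriv2)+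

lemma f_of_in_range: "y \<in> cone x \<Longrightarrow> f_of x y \<in> f_range Zh x"
  unfolding f_of_def f_range_def mem_Collect_eq
  by (intro exI[of _ "c2 x y"] exI[of _ "t_of x y"]) (simp add: c2_def cone_def)

lemma f_of_derivative:
  assumes "y \<in> cone x"
  shows "(f_of x has_derivative df x y) (at y)"
proof -
  have pos: "w2 x \<bullet> y > 0" "w3 x \<bullet> y > 0" using assms by (auto simp: cone_def)
  note [derivative_intros] = Zh_t_of_derivative(1)[OF assms]
  show ?thesis
    unfolding f_of_def[abs_def] c2_def[abs_def] df_def[abs_def]
    apply (rule derivative_eq_intros refl | (use pos in simp; fail))+
    using pos
    apply (simp add: fun_eq_iff dt_def)
    apply (simp add: field_simps)
    done
qed

lemma F_derivative:
  assumes "y \<in> cone x"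
  shows "(F x has_derivative dF x y) (at y)"
proof -
  note [derivative_intros] = DERIV_compose_FDERIV[OF
      Ck_on_2_real(1)[OF Uh_smooth f_of_in_range[OF assms]] f_of_derivative[OF assms]]
  have "((\<lambda>y. (w3 x \<bullet> y) * Uh x (f_of x y)) has_derivative dF x y) (at y)"
    unfolding dF_def[abs_def]
    by (auto intro!: derivative_eq_intros)
  then show ?thesis
    by (rule has_derivative_transform_within_open[OF _ open_cone assms])
      (simp add: F_form f_of_def)
qed

lemma theta_derivative:
  assumes "y \<in> cone x"
  shows "(theta x has_derivative (\<lambda>v. df x y v * deriv (\<theta>b x) (f_of x y))) (at y)"
  using DERIV_compose_FDERIV[OF Ck_on_1_real(1)[OF \<theta>b_smooth f_of_in_range[OF assms]] f_of_derivative[OF assms]]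
  by (simp add: theta_def[abs_def] f_of_def)

lemma phi_derivative:
  assumes "y \<in> cone x"
  shows "(phi x has_derivative (\<lambda>v. dt x y v * deriv (\<phi>b x) (t_of x y))) (at y)"
  using DERIV_compose_FDERIV[OF Ck_on_1_real(1)[OF \<phi>b_smooth UNIV_I] t_of_derivative[OF assms]]
  by (simp add: phi_def[abs_def])

lemma linear_differentials:
  assumes "y \<in> cone x"
  shows "linear (dF x y)" "linear (df x y)" "linear (dt x y)"
  using F_derivative f_of_derivative t_of_derivative assms has_derivative_linear by blast+

text \<open>The last two terms of this derivative come from the homogeneity of degree zero of \<open>f\<close>; they
  cancel the mixed terms in the derivative of \<open>dF\<close>.\<close>
lemma df_derivative:
  assumes "y \<in> cone x"
  shows "((\<lambda>u. df x u v) has_derivative (\<lambda>w.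
     ((w2 x \<bullet> y) * deriv (deriv (Zh x)) (t_of x y) * dt x y v * dt x y w
      - (w3 x \<bullet> v) * df x y w - (w3 x \<bullet> w) * df x y v) / (w3 x \<bullet> y))) (at y)"
proof -
  have pos: "w2 x \<bullet> y > 0" "w3 x \<bullet> y > 0" using assms by (auto simp: cone_def)
  note [derivative_intros] = t_of_derivative[OF assms] f_of_derivative[OF assms]
    Zh_t_of_derivative[OF assms]
  have dtv: "w1 x \<bullet> v = dt x y v * (w2 x \<bullet> y) + t_of x y * (w2 x \<bullet> v)" for v
    using pos by (simp add: dt_def)
  show ?thesis
    unfolding df_def[of x _ v]
    apply (rule derivative_eq_intros refl | (use pos in simp; fail))+
    using pos
    apply (simp add: fun_eq_iff dtv)
    apply (simp add: field_simps)
    done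
qed

lemma dF_derivative:
  assumes "open (f_range Zh x)" and "y \<in> cone x"
  shows "((\<lambda>u. dF x u v) has_derivative (\<lambda>w.
     (w3 x \<bullet> y) * deriv (deriv (Uh x)) (f_of x y) * df x y v * df x y w
      + deriv (Uh x) (f_of x y) * (w2 x \<bullet> y) * deriv (deriv (Zh x)) (t_of x y) * dt x y v * dt x y w))
     (at y)"
proof -
  have pos: "w2 x \<bullet> y > 0" "w3 x \<bullet> y > 0" using assms by (auto simp: cone_def)
  note [derivative_intros] = df_derivative[OF assms(2)]
    DERIV_compose_FDERIV[OF Ck_on_2_real(1)[OF Uh_smooth f_of_in_range[OF assms(2)]] f_of_derivative[OF assms(2)]]
    DERIV_compose_FDERIV[OF Ck_on_2_real(2)[OF Uh_smooth f_of_in_range[OF assms(2)] assms(1)] f_of_derivative[OF assms(2)]]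
  show ?thesis
    unfolding dF_def
    apply (rule derivative_eq_intros refl)+
    using pos
    apply (simp add: fun_eq_iff)
    apply (simp add: field_simps)
    done
qed

lemma metric_tensor_quadratic_form:
  assumes "open (f_range Zh x)" and "y \<in> cone x"
  shows "v \<bullet> (metric_tensor (F x) y *v v) = (dF x y v)\<^sup>2
    + F x y * (w3 x \<bullet> y) * deriv (deriv (Uh x)) (f_of x y) * (df x y v)\<^sup>2
    + F x y * deriv (Uh x) (f_of x y) * (w2 x \<bullet> y) * deriv (deriv (Zh x)) (t_of x y) * (dt x y v)\<^sup>2"
proof (rule quadratic_form_of_products)
  fix i j :: 3
  have 1: "pd j (\<lambda>u. (F x u)\<^sup>2) u = 2 * F x u * dF x u (axis j 1)" if "u \<in> cone x" for u
    by (subst pd_eq_derivative) (auto intro!: derivative_eq_intros F_derivative[OF that])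
  have "((\<lambda>u. 2 * F x u * dF x u (axis j 1)) has_derivative (\<lambda>w. 2 * (dF x y w * dF x y (axis j 1) + F x y *
     ((w3 x \<bullet> y) * deriv (deriv (Uh x)) (f_of x y) * df x y (axis j 1) * df x y w
      + deriv (Uh x) (f_of x y) * (w2 x \<bullet> y) * deriv (deriv (Zh x)) (t_of x y) * dt x y (axis j 1) * dt x y w))))
     (at y)"
    by (auto intro!: derivative_eq_intros F_derivative dF_derivative assms simp: algebra_simps fun_eq_iff)
  then have "((\<lambda>u. pd j (\<lambda>u. (F x u)\<^sup>2) u) has_derivative (\<lambda>w. 2 * (dF x y w * dF x y (axis j 1) + F x y *
     ((w3 x \<bullet> y) * deriv (deriv (Uh x)) (f_of x y) * df x y (axis j 1) * df x y w
      + deriv (Uh x) (f_of x y) * (w2 x \<bullet> y) * deriv (deriv (Zh x)) (t_of x y) * dt x y (axis j 1) * dt x y w))))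
     (at y)"
    by (rule has_derivative_transform_within_open[OF _ open_cone assms(2)]) (simp add: 1)
  from pd_eq_derivative[OF this, of i]
  show "metric_tensor (F x) y $ i $ j = dF x y (axis i 1) * dF x y (axis j 1)
    + F x y * (w3 x \<bullet> y) * deriv (deriv (Uh x)) (f_of x y) * (df x y (axis i 1) * df x y (axis j 1))
    + F x y * deriv (Uh x) (f_of x y) * (w2 x \<bullet> y) * deriv (deriv (Zh x)) (t_of x y) * (dt x y (axis i 1) * dt x y (axis j 1))"
    by (simp add: metric_tensor_def algebra_simps)
qed (use linear_differentials assms in auto)

end

section \<open>Comparison with the angle representation\<close>
context UZ_finsleroid_space
begin

lemma angle_quadratic_form:
  assumes "y \<in> cone x"
  shows "v \<bullet> (metric_tensor (F x) y *v v) = (dF x y v)\<^sup>2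
    + (F x y)\<^sup>2 / (H x)\<^sup>2 * (deriv (\<theta>b x) (f_of x y))\<^sup>2 * (df x y v)\<^sup>2
    + (F x y)\<^sup>2 / (H x)\<^sup>2 * (sin (\<theta>b x (f_of x y)))\<^sup>2 * (deriv (\<phi>b x) (t_of x y))\<^sup>2 * (dt x y v)\<^sup>2"
proof (rule quadratic_form_of_products)
  fix i j
  have regroup: "1 / h * (b * d * (b' * d) + s * (c * e) * (c' * e)) * G
    = G / h * d\<^sup>2 * (b * b') + G / h * s * e\<^sup>2 * (c * c')" for h b b' c c' d e s G :: real
    by (simp add: power2_eq_square algebra_simps add_divide_distrib)
  show "metric_tensor (F x) y $ i $ j = dF x y (axis i 1) * dF x y (axis j 1)
    + (F x y)\<^sup>2 / (H x)\<^sup>2 * (deriv (\<theta>b x) (f_of x y))\<^sup>2 * (df x y (axis i 1) * df x y (axis j 1))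
    + (F x y)\<^sup>2 / (H x)\<^sup>2 * (sin (\<theta>b x (f_of x y)))\<^sup>2 * (deriv (\<phi>b x) (t_of x y))\<^sup>2 *
     (dt x y (axis i 1) * dt x y (axis j 1))"
    unfolding angle_representation[OF assms] pd_eq_derivative[OF F_derivative[OF assms]]
      pd_eq_derivative[OF theta_derivative[OF assms]] pd_eq_derivative[OF phi_derivative[OF assms]]
    unfolding theta_def f_of_def[symmetric] by (simp only: regroup add.assoc)
qed (use linear_differentials assms in auto)

text \<open>Where \<open>Z\<close> vanishes, \<open>f\<close> has a critical direction with \<open>z\<close> and \<open>t\<close> fixed, and the angle
  representation sees only the changes of \<open>F\<close>, \<open>f\<close> and \<open>t\<close>.\<close>
lemma Zh_nonzero: "Zh x t \<noteq> 0"
proof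
  assume Z0: "Zh x t = 0"
  obtain y where y: "y \<in> cone x" "t_of x y = t"
    by (rule exists_cone_vector[of 1]) auto
  obtain v where v: "w1 x \<bullet> v = t" "w2 x \<bullet> v = 1" "w3 x \<bullet> v = 0"
    by (rule exists_vector_with_components)
  have "dt x y v = 0" "df x y v = 0" "dF x y v = 0"
    using v y Z0 by (auto simp: dt_def df_def dF_def)
  then have "v \<bullet> (metric_tensor (F x) y *v v) = 0"
    by (simp add: angle_quadratic_form y)
  moreover have "v \<noteq> 0" using v by auto
  ultimately show False using metric_pos_def y(1) by (metis less_irrefl)
qed

lemma Zh_constant_sign: "sgn (Zh x t) = sgn (Zh x 0)"
proof (rule ccontr)
  assume "sgn (Zh x t) \<noteq> sgn (Zh x 0)"
  then have "Zh x t * Zh x 0 < 0"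
    using Zh_nonzero[of x t] Zh_nonzero[of x 0]
    by (auto simp: sgn_real_def mult_less_0_iff split: if_splits)
  moreover have "continuous_on UNIV (Zh x)"
    using Zh_deriv by (meson DERIV_continuous_on has_field_derivative_at_within)
  then have "connected (range (Zh x))"
    by (intro connected_continuous_image connected_UNIV)
  ultimately have "0 \<in> range (Zh x)"
    unfolding connected_iff_interval mult_less_0_iff
    by (metis less_imp_le rangeI)
  then show False using Zh_nonzero by (metis imageE)
qed

text \<open>The two half-lines are open and convex: openness makes the second derivative of \<open>U\<close> depend on
  its values on the range alone, and convexity makes a function with zero derivative constant.\<close>
lemma f_range_half_line: "f_range Zh x = {f. 0 < sgn (Zh x 0) * f}"
proof (intro equalityI subsetI)
  fix f assume "f \<in> f_range Zh x"
  then obtain c t where f: "f = c * Zh x t" "0 < c" by (auto simp: f_range_def)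
  have "0 < sgn (Zh x t) * f"
    using f Zh_nonzero[of x t] by (auto simp: sgn_real_def mult_less_0_iff)
  then show "f \<in> {f. 0 < sgn (Zh x 0) * f}" by (simp only: mem_Collect_eq Zh_constant_sign[of x t])
next
  fix f assume "f \<in> {f. 0 < sgn (Zh x 0) * f}"
  then have "0 < f / Zh x 0"
    using Zh_nonzero[of x 0] by (auto simp: sgn_real_def zero_less_divide_iff split: if_splits)
  moreover have "f = f / Zh x 0 * Zh x 0" using Zh_nonzero by simp
  ultimately show "f \<in> f_range Zh x" unfolding f_range_def by blast
qed

lemma
  shows open_f_range: "open (f_range Zh x)"
    and convex_f_range: "convex (f_range Zh x)"
proof -
  show "open (f_range Zh x)" unfolding f_range_half_line
    by (intro open_Collect_less continuous_intros)
  have "{f. 0 < sgn (Zh x 0) * f} = {0<..} \<or> {f. 0 < sgn (Zh x 0) * f} = {..<0}"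
    using Zh_nonzero[of x 0] by (auto simp: sgn_real_def)
  then show "convex (f_range Zh x)" unfolding f_range_half_line
    by (metis convex_real_interval(3) convex_real_interval(4))
qed

lemma Uh_pos: "f \<in> f_range Zh x \<Longrightarrow> 0 < Uh x f"
proof -
  assume "f \<in> f_range Zh x"
  then obtain c t where f: "f = c * Zh x t" "0 < c" by (auto simp: f_range_def)
  obtain y where y: "y \<in> cone x" "c2 x y = c" "t_of x y = t"
    by (rule exists_cone_vector[OF f(2)])
  have "0 < (w3 x \<bullet> y) * Uh x f" using F_pos[OF y(1)] F_form[OF y(1)] f y by simp
  then show ?thesis using y(1) by (auto simp: cone_def zero_less_mult_iff)
qed

lemma exists_null_direction_of_df:
  assumes "y \<in> cone x"
  obtains v where "w3 x \<bullet> v = 0" "df x y v = 0" "dt x y v \<noteq> 0"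
proof -
  define t where "t = t_of x y"
  obtain v where "w1 x \<bullet> v = Zh x t - t * deriv (Zh x) t" "w2 x \<bullet> v = - deriv (Zh x) t" "w3 x \<bullet> v = 0"
    by (rule exists_vector_with_components)
  then show ?thesis
    using that[of v] assms Zh_nonzero[of x t]
    by (auto simp: df_def dt_def cone_def t_def[symmetric] algebra_simps)
qed

lemma nondegenerate_angles:
  shows "f \<in> f_range Zh x \<Longrightarrow> sin (\<theta>b x f) \<noteq> 0"
    and "deriv (\<phi>b x) t \<noteq> 0"
proof -
  have *: "sin (\<theta>b x (c * Zh x t)) \<noteq> 0 \<and> deriv (\<phi>b x) t \<noteq> 0" if c: "0 < c" for c t
  proof -
    obtain y where y: "y \<in> cone x" "c2 x y = c" "t_of x y = t"
      by (rule exists_cone_vector[OF c])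
    obtain v where v: "w3 x \<bullet> v = 0" "df x y v = 0" "dt x y v \<noteq> 0"
      by (rule exists_null_direction_of_df[OF y(1)])
    have "v \<noteq> 0" using v(3) linear_0[OF linear_differentials(3)[OF y(1)]] by auto
    moreover have "dF x y v = 0" using v by (simp add: dF_def)
    ultimately show ?thesis
      using metric_pos_def[OF y(1), of v] angle_quadratic_form[OF y(1), of v] v y
      by (auto simp: f_of_def)
  qed
  show "f \<in> f_range Zh x \<Longrightarrow> sin (\<theta>b x f) \<noteq> 0" using * by (auto simp: f_range_def)
  show "deriv (\<phi>b x) t \<noteq> 0" using *[of 1] by simp
qed

text \<open>With \<open>\<partial>\<theta>/\<partial>f = 0\<close> the metric would not see a direction that changes \<open>f\<close> while
  keeping \<open>t\<close> and \<open>F\<close> fixed. Such a direction has \<open>dz\<close> proportional to \<open>U'\<close> and \<open>z df\<close> to \<open>- U\<close>.\<close>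
lemma deriv_\<theta>b_nonzero:
  assumes "f \<in> f_range Zh x"
  shows "deriv (\<theta>b x) f \<noteq> 0"
proof -
  obtain c t where f: "f = c * Zh x t" "0 < c" using assms by (auto simp: f_range_def)
  obtain y where y: "y \<in> cone x" "c2 x y = c" "t_of x y = t"
    by (rule exists_cone_vector[OF f(2)])
  have fy: "f_of x y = f" using f y by (simp add: f_of_def)
  have U: "Uh x f > 0" using Uh_pos assms by blast
  define k where "k = f * deriv (Uh x) f - Uh x f"
  define Zt where "Zt = Zh x t"
  have [simp]: "Zt \<noteq> 0" using Zh_nonzero by (simp add: Zt_def)
  obtain v where v: "w1 x \<bullet> v = t * k / Zt" "w2 x \<bullet> v = k / Zt" "w3 x \<bullet> v = deriv (Uh x) f"
    by (rule exists_vector_with_components)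
  have z: "w3 x \<bullet> y > 0" using y by (auto simp: cone_def)
  have "dt x y v = 0" using v y by (simp add: dt_def)
  moreover have dfv: "(w3 x \<bullet> y) * df x y v = - Uh x f"
    using v y z f by (simp add: df_def fy k_def Zt_def[symmetric])
  then have "dF x y v = 0"
    by (simp add: dF_def fy v algebra_simps mult.assoc[symmetric])
  moreover have "v \<noteq> 0" using dfv U linear_0[OF linear_differentials(2)[OF y(1)]] by auto
  ultimately show ?thesis
    using metric_pos_def[OF y(1), of v] angle_quadratic_form[OF y(1), of v] fy
    by auto
qed

text \<open>The first equation comes from a vector with \<open>dt = 0\<close>, \<open>df \<noteq> 0\<close>, the second from one with
  \<open>df = 0\<close>, \<open>dt \<noteq> 0\<close>. In the second \<open>Z''\<close> cancels because \<open>\<partial>\<phi>/\<partial>t \<noteq> 0\<close> makes it nonzero.\<close>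
lemma characteristic_equations:
  assumes C_eq: "\<And>t. (deriv (\<phi>b x) t)\<^sup>2 = C * (1 / Zh x t) * deriv (deriv (Zh x)) t"
    and "f \<in> f_range Zh x"
  shows "(deriv (\<theta>b x) f)\<^sup>2 = (H x)\<^sup>2 * (1 / Uh x f) * deriv (deriv (Uh x)) f"
    and "1 / Uh x f * deriv (Uh x) f * f = C / (H x)\<^sup>2 * (sin (\<theta>b x f))\<^sup>2"
proof -
  obtain c t where f: "f = c * Zh x t" "0 < c" using assms by (auto simp: f_range_def)
  obtain y where y: "y \<in> cone x" "c2 x y = c" "t_of x y = t"
    by (rule exists_cone_vector[OF f(2)])
  have fy: "f_of x y = f" using f y by (simp add: f_of_def)
  have U: "Uh x f > 0" using Uh_pos assms by blast
  have H: "H x > 0" by (rule H_bounds)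
  have z: "w3 x \<bullet> y > 0" using y by (auto simp: cone_def)
  have Z: "Zh x t \<noteq> 0" by (rule Zh_nonzero)
  have Fy: "F x y = (w3 x \<bullet> y) * Uh x f" using F_form[OF y(1)] f y by simp
  have y2: "w2 x \<bullet> y = c * (w3 x \<bullet> y)" using y z by (auto simp: c2_def)
  have eq: "F x y * (w3 x \<bullet> y) * deriv (deriv (Uh x)) f * (df x y v)\<^sup>2
    + F x y * deriv (Uh x) f * (w2 x \<bullet> y) * deriv (deriv (Zh x)) t * (dt x y v)\<^sup>2
    = (F x y)\<^sup>2 / (H x)\<^sup>2 * (deriv (\<theta>b x) f)\<^sup>2 * (df x y v)\<^sup>2
    + (F x y)\<^sup>2 / (H x)\<^sup>2 * (sin (\<theta>b x f))\<^sup>2 * (deriv (\<phi>b x) t)\<^sup>2 * (dt x y v)\<^sup>2" for v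
    using angle_quadratic_form[OF y(1), of v]
    unfolding metric_tensor_quadratic_form[OF open_f_range y(1)] fy y(3) by simp
  obtain v where v: "w1 x \<bullet> v = t" "w2 x \<bullet> v = 1" "w3 x \<bullet> v = 0"
    by (rule exists_vector_with_components)
  have "dt x y v = 0" "df x y v \<noteq> 0" using v y z Z by (auto simp: dt_def df_def)
  then have "F x y * (w3 x \<bullet> y) * deriv (deriv (Uh x)) f * (df x y v)\<^sup>2
     = (F x y)\<^sup>2 / (H x)\<^sup>2 * (deriv (\<theta>b x) f)\<^sup>2 * (df x y v)\<^sup>2"
    using eq[of v] by simp
  then have "F x y * (w3 x \<bullet> y) * deriv (deriv (Uh x)) f = (F x y)\<^sup>2 / (H x)\<^sup>2 * (deriv (\<theta>b x) f)\<^sup>2"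
    by (rule mult_right_cancel[THEN iffD1, rotated]) (simp add: \<open>df x y v \<noteq> 0\<close>)
  then show "(deriv (\<theta>b x) f)\<^sup>2 = (H x)\<^sup>2 * (1 / Uh x f) * deriv (deriv (Uh x)) f"
    using z U H unfolding Fy by (simp add: field_simps power2_eq_square)
  obtain v where v: "w3 x \<bullet> v = 0" "df x y v = 0" "dt x y v \<noteq> 0"
    by (rule exists_null_direction_of_df[OF y(1)])
  have "F x y * deriv (Uh x) f * (w2 x \<bullet> y) * deriv (deriv (Zh x)) t * (dt x y v)\<^sup>2
    = (F x y)\<^sup>2 / (H x)\<^sup>2 * (sin (\<theta>b x f))\<^sup>2 * (deriv (\<phi>b x) t)\<^sup>2 * (dt x y v)\<^sup>2"
    using eq[of v] v by simp
  then have "F x y * deriv (Uh x) f * (w2 x \<bullet> y) * deriv (deriv (Zh x)) t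
    = (F x y)\<^sup>2 / (H x)\<^sup>2 * (sin (\<theta>b x f))\<^sup>2 * (deriv (\<phi>b x) t)\<^sup>2"
    by (rule mult_right_cancel[THEN iffD1, rotated]) (simp add: v)
  also have "\<dots> = (F x y)\<^sup>2 / (H x)\<^sup>2 * (sin (\<theta>b x f))\<^sup>2 * (C * (1 / Zh x t)) * deriv (deriv (Zh x)) t"
    by (simp add: C_eq)
  finally have "F x y * deriv (Uh x) f * (w2 x \<bullet> y)
    = (F x y)\<^sup>2 / (H x)\<^sup>2 * (sin (\<theta>b x f))\<^sup>2 * (C * (1 / Zh x t))"
    by (rule mult_right_cancel[THEN iffD1, rotated])
      (use nondegenerate_angles(2)[of x t] C_eq[of t] in auto)
  then show "1 / Uh x f * deriv (Uh x) f * f = C / (H x)\<^sup>2 * (sin (\<theta>b x f))\<^sup>2"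
    using z U H Z unfolding Fy y2 f(1)[symmetric] by (simp add: f(1) field_simps power2_eq_square)
qed

section \<open>Integration along the range of f\<close>
lemma C_pos:
  assumes C_eq: "\<And>t. (deriv (\<phi>b x) t)\<^sup>2 = C * (1 / Zh x t) * deriv (deriv (Zh x)) t"
  shows "0 < C"
proof (rule ccontr)
  assume "\<not> 0 < C"
  define \<sigma> where "\<sigma> = sgn (Zh x 0)"
  have pos: "0 < \<sigma> * Zh x t" for t
    using Zh_nonzero[of x t] unfolding \<sigma>_def Zh_constant_sign[of x t, symmetric]
    by (simp add: sgn_real_def)
  have C_pos': "0 < C * (1 / Zh x t) * deriv (deriv (Zh x)) t" for t
    using nondegenerate_angles(2)[of x t] unfolding C_eq[of t, symmetric] by simp
  have "\<sigma> * deriv (deriv (Zh x)) t \<le> 0" for t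
    using C_pos'[of t] pos[of t] \<open>\<not> 0 < C\<close>
    by (auto simp: zero_less_mult_iff mult_less_0_iff zero_less_divide_iff divide_less_0_iff mult_le_0_iff)
  then have "\<sigma> * deriv (Zh x) t = 0" for t
    using positive_concave_imp_constant[OF DERIV_cmult[OF Zh_deriv] DERIV_cmult[OF Zh_deriv2] pos] by blast
  moreover have "\<sigma> \<noteq> 0" using pos[of 0] by auto
  ultimately have "deriv (Zh x) = (\<lambda>_. 0)" by (simp add: fun_eq_iff)
  then show False using C_pos'[of 0] by simp
qed

text \<open>Differentiating \<open>f U' = T sin\<^sup>2 \<theta> U\<close> brings in \<open>f U''\<close>, which the first characteristic equation
  replaces by \<open>\<theta>'\<^sup>2\<close>; with \<open>f \<theta>' = p sin \<theta>\<close> the common factor \<open>U sin\<^sup>2 \<theta>\<close> cancels.\<close>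
lemma drift_quadratic:
  fixes f :: real and x :: 'm
  defines "p \<equiv> f * deriv (\<theta>b x) f / sin (\<theta>b x f)"
  assumes C_eq: "\<And>t. (deriv (\<phi>b x) t)\<^sup>2 = C * (1 / Zh x t) * deriv (deriv (Zh x)) t"
    and f: "f \<in> f_range Zh x"
  shows "(p - C * cos (\<theta>b x f))\<^sup>2 = C\<^sup>2 * L17 C (H x) (\<theta>b x f)"
proof -
  define T where "T = C / (H x)\<^sup>2"
  define s c U U' U'' \<theta>' where "s = sin (\<theta>b x f)" and "c = cos (\<theta>b x f)" and "U = Uh x f"
    and "U' = deriv (Uh x) f" and "U'' = deriv (deriv (Uh x)) f" and "\<theta>' = deriv (\<theta>b x) f"
  have C: "0 < C" by (rule C_pos[OF C_eq])
  have H: "0 < H x" by (rule H_bounds)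
  have U: "0 < U" using Uh_pos f by (simp add: U_def)
  have s: "s \<noteq> 0" using nondegenerate_angles(1) f by (simp add: s_def)
  have ps: "f * \<theta>' = p * s" using s by (simp add: p_def s_def \<theta>'_def)
  note ceq = characteristic_equations[OF C_eq]
  have 1: "h * deriv (Uh x) h = T * (sin (\<theta>b x h))\<^sup>2 * Uh x h" if "h \<in> f_range Zh x" for h
    using ceq(2)[OF that] Uh_pos[OF that] by (simp add: T_def field_simps)
  have "((\<lambda>h. h * deriv (Uh x) h) has_real_derivative U' + f * U'') (at f)"
    unfolding U'_def U''_def
    by (auto intro!: derivative_eq_intros Ck_on_2_real(2)[OF Uh_smooth f open_f_range])
  moreover have "((\<lambda>h. T * (sin (\<theta>b x h))\<^sup>2 * Uh x h) has_real_derivative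
      T * (2 * s * c * \<theta>') * U + T * s\<^sup>2 * U') (at f)"
    unfolding U'_def \<theta>'_def s_def c_def U_def
    by (auto intro!: derivative_eq_intros Ck_on_2_real(1)[OF Uh_smooth f]
        Ck_on_1_real(1)[OF \<theta>b_smooth f])
  then have "((\<lambda>h. h * deriv (Uh x) h) has_real_derivative
      T * (2 * s * c * \<theta>') * U + T * s\<^sup>2 * U') (at f)"
    by (rule has_field_derivative_transform_within_open[OF _ open_f_range f]) (simp add: 1)
  ultimately have 2: "U' + f * U'' = T * (2 * s * c * \<theta>') * U + T * s\<^sup>2 * U'"
    by (rule DERIV_unique)
  have 3: "f * U' = T * s\<^sup>2 * U" using 1[OF f] by (simp add: U'_def s_def U_def)
  have T: "C = T * (H x)\<^sup>2" using H by (simp add: T_def)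
  have 4: "\<theta>'\<^sup>2 * U = (H x)\<^sup>2 * U''"
    using ceq(1)[OF f] U by (simp add: \<theta>'_def U_def U''_def field_simps)
  have "U * s\<^sup>2 * (p\<^sup>2 + C) = U * s\<^sup>2 * (2 * C * c * p + C * T * s\<^sup>2)"
    using 2 3 4 T ps by algebra
  then have 5: "p\<^sup>2 + C = 2 * C * c * p + C * T * s\<^sup>2" using U s by simp
  have "C\<^sup>2 * L17 C (H x) (\<theta>b x f) = C * T * s\<^sup>2 - C * (s\<^sup>2 + c\<^sup>2) + C\<^sup>2 * c\<^sup>2"
    using C H unfolding L17_def T_def s_def[symmetric] c_def[symmetric]
    by (simp add: field_simps power2_eq_square)
  also have "s\<^sup>2 + c\<^sup>2 = 1" by (simp add: s_def c_def)
  finally show ?thesis using 5 unfolding c_def[symmetric] by algebra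
qed

text \<open>The half-line over which \<open>f\<close> ranges is parametrized by \<open>\<plusminus> exp u\<close>, so that \<open>u\<close> covers all
  reals.\<close>
lemma C_ge_1:
  assumes C_eq: "\<And>t. (deriv (\<phi>b x) t)\<^sup>2 = C * (1 / Zh x t) * deriv (deriv (Zh x)) t"
    and oriented: "\<And>f. f \<in> f_range Zh x \<Longrightarrow> C * cos (\<theta>b x f) \<le> f * deriv (\<theta>b x) f / sin (\<theta>b x f)"
  shows "1 \<le> C"
proof -
  define e where "e = (\<lambda>u. sgn (Zh x 0) * exp u)"
  define g where "g = (\<lambda>u. \<theta>b x (e u))"
  define p where "p = (\<lambda>u. e u * deriv (\<theta>b x) (e u) / sin (g u))"
  have e: "e u \<in> f_range Zh x" for u
    using Zh_nonzero[of x 0] by (simp add: f_range_half_line e_def sgn_real_def)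
  have e0: "e u \<noteq> 0" for u using Zh_nonzero by (simp add: e_def sgn_zero_iff)
  have de: "(e has_real_derivative e u) (at u)" for u
    unfolding e_def by (auto intro!: derivative_eq_intros)
  have s: "sin (g u) \<noteq> 0" for u using nondegenerate_angles(1)[OF e] by (simp add: g_def)
  have dg: "(g has_real_derivative p u * sin (g u)) (at u)" for u
    using DERIV_chain2[OF Ck_on_1_real(1)[OF \<theta>b_smooth e] de] s[of u]
    by (simp add: g_def p_def mult.commute)
  have conte: "continuous_on UNIV e"
    by (rule DERIV_continuous_on[OF has_field_derivative_at_within[OF de]])
  have contg: "continuous_on UNIV g"
    by (rule DERIV_continuous_on[OF has_field_derivative_at_within[OF dg]])
  have "continuous_on UNIV (\<lambda>u. deriv (\<theta>b x) (e u))"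
    by (rule continuous_on_compose2[OF Ck_on_1_real(2)[OF \<theta>b_smooth] conte]) (use e in auto)
  then have "continuous_on UNIV p"
    unfolding p_def using s by (intro continuous_intros conte contg) auto
  moreover have "p u \<noteq> 0" for u
    using e0[of u] s[of u] deriv_\<theta>b_nonzero[OF e, of u] by (simp add: p_def)
  ultimately show ?thesis
    using full_angle_range_imp_C_ge_1[OF C_pos[OF C_eq] dg]
      drift_quadratic[OF C_eq e] oriented[OF e]
    unfolding p_def g_def by blast
qed

lemma explicit_characteristic_functions:
  assumes C_eq: "\<And>t. (deriv (\<phi>b x) t)\<^sup>2 = C * (1 / Zh x t) * deriv (deriv (Zh x)) t"
    and oriented: "\<And>f. f \<in> f_range Zh x \<Longrightarrow> C * cos (\<theta>b x f) \<le> f * deriv (\<theta>b x) f / sin (\<theta>b x f)"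
  shows "\<exists>C22 C33. \<forall>\<theta>\<in>\<theta>b x ` f_range Zh x.
        Ub x \<theta> = C22 * (1 / R17 C (H x) \<theta>) * I_exp C (H x) \<theta> \<and>
        fb x \<theta> = C33 * (sin \<theta> / R17 C (H x) \<theta>) * Y1 C (H x) \<theta>"
proof -
  have C1: "1 \<le> C" by (rule C_ge_1[OF C_eq oriented])
  have f0: "f \<noteq> 0" if "f \<in> f_range Zh x" for f using that by (auto simp: f_range_half_line)
  note s = nondegenerate_angles(1)[of _ x]
  have p: "f * deriv (\<theta>b x) f / sin (\<theta>b x f) = C * R17 C (H x) (\<theta>b x f)" if f: "f \<in> f_range Zh x" for f
  proof -
    have "f * deriv (\<theta>b x) f / sin (\<theta>b x f) - C * cos (\<theta>b x f) = sqrt (C\<^sup>2 * L17 C (H x) (\<theta>b x f))"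
      by (rule real_sqrt_unique[symmetric]) (use drift_quadratic[OF C_eq f] oriented[OF f] in auto)
    then show ?thesis using C1 by (simp add: R17_def real_sqrt_mult algebra_simps)
  qed
  have \<theta>': "deriv (\<theta>b x) f = C * sin (\<theta>b x f) * R17 C (H x) (\<theta>b x f) / f" if f: "f \<in> f_range Zh x" for f
    using p[OF f] s[OF f] f0[OF f] by (simp add: field_simps)
  have R: "R17 C (H x) (\<theta>b x f) \<noteq> 0" if f: "f \<in> f_range Zh x" for f
    using deriv_\<theta>b_nonzero[OF f] \<theta>'[OF f] by auto
  have U': "deriv (Uh x) f = Uh x f * (C / (H x)\<^sup>2 * (sin (\<theta>b x f))\<^sup>2) / f" if f: "f \<in> f_range Zh x" for f
    unfolding characteristic_equations(2)[OF C_eq f, symmetric] using Uh_pos[OF f] f0[OF f] by simp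
  have d\<theta>: "(\<theta>b x has_real_derivative C * sin (\<theta>b x f) * R17 C (H x) (\<theta>b x f) / f) (at f)"
    if f: "f \<in> f_range Zh x" for f
    using Ck_on_1_real(1)[OF \<theta>b_smooth f] unfolding \<theta>'[OF f] .
  have dU: "(Uh x has_real_derivative Uh x f * (C / (H x)\<^sup>2 * (sin (\<theta>b x f))\<^sup>2) / f) (at f)"
    if f: "f \<in> f_range Zh x" for f
    using Ck_on_2_real(1)[OF Uh_smooth f] unfolding U'[OF f] .
  obtain C22 C33 where
    "\<And>f. f \<in> f_range Zh x \<Longrightarrow> Uh x f = C22 * (1 / R17 C (H x) (\<theta>b x f)) * I_exp C (H x) (\<theta>b x f)"
    "\<And>f. f \<in> f_range Zh x \<Longrightarrow> f = C33 * (sin (\<theta>b x f) / R17 C (H x) (\<theta>b x f)) * Y1 C (H x) (\<theta>b x f)"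
    using integrated_characteristic_equations[OF C1 H_bounds convex_f_range f0 s R d\<theta> dU] by blast
  then show ?thesis by (intro exI[of _ C22] exI[of _ C33]) (auto simp: Ub_eq fb_\<theta>b)
qed

end

theorem proposition4p1:
  fixes cdom :: "'m::{t2_space,second_countable_topology} \<Rightarrow> 'm set"
    and crd :: "'m \<Rightarrow> 'm \<Rightarrow> real ^ 3"
    and w1 w2 w3 :: "'m \<Rightarrow> real ^ 3"
    and F :: "'m \<Rightarrow> real ^ 3 \<Rightarrow> real"
    and Uh Zh Ub fb Zb tb \<theta>b \<phi>b :: "'m \<Rightarrow> real \<Rightarrow> real"
    and H C T :: "'m \<Rightarrow> real"
  assumes finsleroid: "UZ_finsleroid_space cdom crd w1 w2 w3 F Uh Zh Ub fb Zb tb \<theta>b \<phi>b H"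
    and C_eq: "\<And>x t. (deriv (\<phi>b x) t)\<^sup>2 = C x * (1 / Zh x t) * deriv (deriv (Zh x)) t"
    and T_eq: "\<And>x. T x = C x / (H x)\<^sup>2"
    and oriented: "theta_oriented C Zh \<theta>b"
  shows
    "(\<forall>x. \<forall>f\<in>f_range Zh x.
        (deriv (\<theta>b x) f)\<^sup>2 = (H x)\<^sup>2 * (1 / Uh x f) * deriv (deriv (Uh x)) f \<and>
        1 / Uh x f * deriv (Uh x) f * f = T x * (sin (\<theta>b x f))\<^sup>2)
     \<and>
     (\<exists>C22 C33 :: 'm \<Rightarrow> real. \<forall>x. \<forall>\<theta>\<in>\<theta>b x ` f_range Zh x.
        Ub x \<theta> = C22 x * (1 / R17 (C x) (H x) \<theta>) * I_exp (C x) (H x) \<theta> \<and>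
        fb x \<theta> = C33 x * (sin \<theta> / R17 (C x) (H x) \<theta>) * Y1 (C x) (H x) \<theta>)"
proof -
  interpret UZ_finsleroid_space cdom crd w1 w2 w3 F Uh Zh Ub fb Zb tb \<theta>b \<phi>b H
    by (rule finsleroid)
  have "C x * cos (\<theta>b x f) \<le> f * deriv (\<theta>b x) f / sin (\<theta>b x f)" if "f \<in> f_range Zh x" for x f
    using oriented that unfolding theta_oriented_def by fastforce
  then have "\<forall>x. \<exists>C22 C33. \<forall>\<theta>\<in>\<theta>b x ` f_range Zh x.
        Ub x \<theta> = C22 * (1 / R17 (C x) (H x) \<theta>) * I_exp (C x) (H x) \<theta> \<and>
        fb x \<theta> = C33 * (sin \<theta> / R17 (C x) (H x) \<theta>) * Y1 (C x) (H x) \<theta>"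
    using explicit_characteristic_functions[OF C_eq] by blast
  then have "\<exists>C22 C33. \<forall>x. \<forall>\<theta>\<in>\<theta>b x ` f_range Zh x.
        Ub x \<theta> = C22 x * (1 / R17 (C x) (H x) \<theta>) * I_exp (C x) (H x) \<theta> \<and>
        fb x \<theta> = C33 x * (sin \<theta> / R17 (C x) (H x) \<theta>) * Y1 (C x) (H x) \<theta>"
    by (simp only: choice_iff)
  then show ?thesis
    unfolding T_eq using characteristic_equations[OF C_eq] by blast
qed

end
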